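(* Let $z\in\mathcal{Z}$ and let $\zeta^z$ be the bridge from $0$ to $z$ of random length $\tau$ derived from the Lévy process $X$. Then $\zeta^z$ is an $\mathbb{F}^{\zeta^z}$-Markov process, i.e. for all $0\le t<u$ and all measurable $g$ such that $g(\zeta^z_u)$ is integrable, $\mathbb{E}[g(\zeta^z_u)\mid\mathcal{F}^{\zeta^z}_t]=\mathbb{E}[g(\zeta^z_u)\mid\zeta^z_t]$ $\mathbb{P}$-a.s., with transition law given, for $0\le t<u$, by $$\mathbb{P}(\zeta_u^z\in dy\mid\zeta_t^z=x)=\Bigg[\mathbb{I}_{\{x=z\}}\mathbb{I}_{\{y=z\}}+\int_{(t,u]}\frac{\phi(r,t,x)}{\int_{(t,+\infty)}\phi(s,t,x)\,\mathbb{P}_\tau(ds)}\,\mathbb{P}_\tau(dr)\,\mathbb{I}_{\{x\neq z\}}\mathbb{I}_{\{y=z\}}$$ $$\qquad+f_{u-t}(y-x)\int_{(u,+\infty)}\frac{\phi(r,u,y)}{\int_{(t,+\infty)}\phi(s,t,x)\,\mathbb{P}_\tau(ds)}\,\mathbb{P}_\tau(dr)\,\mathbb{I}_{\{x\neq z\}}\mathbb{I}_{\{y\neq z\}}\Bigg]\varrho(dy),$$ where $\varrho$ is the measure on $\mathcal{B}(\mathbb{R})$ defined by $\varrho(dy)=\delta_z(dy)+\lambda(dy)$, with $\delta_z$ the Dirac measure at $z$ and $\lambda$ Lebesgue measure.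
   Context: $(\Omega,\mathcal{F},\mathbb{P})$ is a complete probability space. $X=(X_t)_{t\ge0}$ is a real-valued symmetric Lévy process with $X_0=0$, with characteristic exponent $\psi$ (so $\mathbb{E}[e^{iuX_t}]=e^{t\psi(u)}$, $\psi$ real-valued), such that $\exp(t\psi)$ is integrable on $\mathbb{R}$ for every $t>0$. Then $X_t$ ($t>0$) has the bounded density $f_t(x)=(2\pi)^{-1}\int_{\mathbb{R}}e^{ixy}e^{t\psi(y)}\,dy$, jointly continuous in $(t,x)\in(0,\infty)\times\mathbb{R}$. Bridge of deterministic length: for $r>0$ and $z\in\mathbb{R}$ with $0<f_r(z)<\infty$, $X^{r,z}$ is the càdlàg process started at $0$ whose finite-dimensional distributions on $(0,r)$ have densities, for $0=t_0<t_1<\dots<t_n<r$ and $x_0=0$, $\frac{f_{r-t_n}(z-x_n)}{f_r(z)}\prod_{i=1}^n f_{t_i-t_{i-1}}(x_i-x_{i-1})$; it is extended by $X^{r,z}_t=z$ for all $t\ge r$. Bridge of random length: $\tau:\Omega\to(0,+\infty)$ is a strictly positive random time with law $\mathbb{P}_\tau$. $\mathcal{Z}$ is the set of $z\in\mathbb{R}$ with $0<f_r(z)<\infty$ for $\mathbb{P}_\tau$-almost every $r$. For $z\in\mathcal{Z}$, a process $\zeta^z$ on $(\Omega,\mathcal{F},\mathbb{P})$ with càdlàg paths is the bridge from $0$ to $z$ of random length $\tau$ derived from $X$ if the conditional distribution of $\zeta^z$ given $\{\tau=r\}$ is the law of $X^{r,z}$ (on the Skorohod space $\mathbb{D}_\infty$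 of càdlàg functions from $[0,+\infty)$ to $\mathbb{R}$). Notation: $\mathbb{F}^{\zeta^z}=(\mathcal{F}^{\zeta^z}_t)_{t\ge0}$ with $\mathcal{F}^{\zeta^z}_t=\sigma(\zeta^z_s,\,s\le t)$ is the natural filtration; $\phi(r,t,x):=\frac{f_{r-t}(z-x)}{f_r(z)}\mathbb{I}_{\{t<r\}}$ for $r>0$, $t\ge0$, $x\in\mathbb{R}$; $\mathbb{I}$ denotes indicator functions; $\mathcal{B}(\mathbb{R})$ is the Borel $\sigma$-algebra of $\mathbb{R}$. A term whose indicator factor vanishes is taken to be $0$.
   Formalization: The transition law is asserted for all 0≤t<u except t=0 with z=0, where the printed formula gives δ_0 although ζ_u is a.s. different from 0 on {τ>u}; the Markov property is asserted without exception. *)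

theory Defs
  imports "HOL-Probability.Probability"
begin

text \<open>
  Processes are curried functions \<open>X t \<omega>\<close> with time in \<^typ>\<open>real\<close>; every condition below
  only refers to times \<open>t \<ge> 0\<close>.
\<close>

section \<open>Paths and conditional laws\<close>

definition cadlag :: "(real \<Rightarrow> real) \<Rightarrow> bool" where
  "cadlag w \<longleftrightarrow>
     (\<forall>t\<ge>0. (w \<longlongrightarrow> w t) (at_right t)) \<and> (\<forall>t>0. \<exists>l. (w \<longlongrightarrow> l) (at_left t))"

text \<open>
  The cadlag functions on \<open>[0, \<infinity>)\<close> (undefined at negative times), with the \<open>\<sigma>\<close>-algebra
  generated by the coordinate maps, which is the Borel \<open>\<sigma>\<close>-algebra of the Skorohod topology.
\<close>

definition skorohod_space :: "(real \<Rightarrow> real) measure" where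
  "skorohod_space = restrict_space (\<Pi>\<^sub>M t\<in>{0..}. borel) {w. cadlag w}"

text \<open>
  \<open>K x\<close> is the conditional distribution of \<open>Y\<close> given \<open>{X = x}\<close>, for almost every \<open>x\<close> under the
  law of \<open>X\<close>.  As such a kernel is only determined up to null sets, \<open>K x\<close> has to be a
  probability measure for almost every \<open>x\<close> only.
\<close>

definition cond_distribution ::
  "'a measure \<Rightarrow> 'b measure \<Rightarrow> ('a \<Rightarrow> 'b) \<Rightarrow> 'c measure \<Rightarrow> ('a \<Rightarrow> 'c) \<Rightarrow> ('b \<Rightarrow> 'c measure) \<Rightarrow> bool"
where
  "cond_distribution M S X N Y K \<longleftrightarrow>
     X \<in> M \<rightarrow>\<^sub>M S \<and> Y \<in> M \<rightarrow>\<^sub>M N \<and>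
     (\<forall>x\<in>space S. sets (K x) = sets N) \<and>
     (AE x in distr M S X. prob_space (K x)) \<and>
     (\<forall>A\<in>sets N. (\<lambda>x. emeasure (K x) A) \<in> borel_measurable S) \<and>
     (\<forall>A\<in>sets N. \<forall>B\<in>sets S.
        emeasure M {\<omega> \<in> space M. X \<omega> \<in> B \<and> Y \<omega> \<in> A} =
          (\<integral>\<^sup>+ x\<in>B. emeasure (K x) A \<partial>distr M S X))"

section \<open>Symmetric Levy processes with integrable characteristic function\<close>

definition levy_process :: "'a measure \<Rightarrow> (real \<Rightarrow> 'a \<Rightarrow> real) \<Rightarrow> bool" where
  "levy_process M X \<longleftrightarrow>
     prob_space M \<and>
     (\<forall>t\<ge>0. X t \<in> borel_measurable M) \<and>
     (AE \<omega> in M. X 0 \<omega> = 0) \<and>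
     (\<forall>(n::nat) (t::nat \<Rightarrow> real). 0 \<le> t 0 \<and> (\<forall>i<n. t i \<le> t (Suc i)) \<longrightarrow>
        prob_space.indep_vars M (\<lambda>_. borel) (\<lambda>i \<omega>. X (t (Suc i)) \<omega> - X (t i) \<omega>) {..<n}) \<and>
     (\<forall>s t. 0 \<le> s \<and> s \<le> t \<longrightarrow>
        distr M borel (\<lambda>\<omega>. X t \<omega> - X s \<omega>) = distr M borel (X (t - s))) \<and>
     (AE \<omega> in M. cadlag (\<lambda>t. X t \<omega>))"

definition symmetric_process :: "'a measure \<Rightarrow> (real \<Rightarrow> 'a \<Rightarrow> real) \<Rightarrow> bool" where
  "symmetric_process M X \<longleftrightarrow>
     (\<forall>t\<ge>0. distr M borel (\<lambda>\<omega>. - X t \<omega>) = distr M borel (X t))"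

definition characteristic_exponent ::
  "'a measure \<Rightarrow> (real \<Rightarrow> 'a \<Rightarrow> real) \<Rightarrow> (real \<Rightarrow> real) \<Rightarrow> bool"
where
  "characteristic_exponent M X \<psi> \<longleftrightarrow>
     (\<forall>t\<ge>0. \<forall>u. char (distr M borel (X t)) u = exp (complex_of_real (t * \<psi> u)))"

text \<open>
  The density \<open>f\<^sub>t(x)\<close> of \<open>X\<^sub>t\<close> for \<open>t > 0\<close>.  The integral is real, because \<open>\<psi>\<close> is
  even; \<^const>\<open>Re\<close> only changes the type.
\<close>

definition levy_density :: "(real \<Rightarrow> real) \<Rightarrow> real \<Rightarrow> real \<Rightarrow> real" where
  "levy_density \<psi> t x =
     Re (1 / (2 * pi) * (CLINT y|lborel. iexp (x * y) * exp (complex_of_real (t * \<psi> y))))"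

section \<open>Bridges\<close>

text \<open>
  \<open>Y\<close>, on the probability space \<open>N\<close>, is a version of the bridge \<open>X\<^sup>r\<^sup>,\<^sup>z\<close> from \<open>0\<close> to \<open>z\<close> of
  deterministic length \<open>r\<close>.  The update \<open>x(0 := 0)\<close> is the convention \<open>x\<^sub>0 = 0\<close>.
\<close>

definition levy_bridge ::
  "(real \<Rightarrow> real) \<Rightarrow> real \<Rightarrow> real \<Rightarrow> 'b measure \<Rightarrow> (real \<Rightarrow> 'b \<Rightarrow> real) \<Rightarrow> bool"
where
  "levy_bridge \<psi> r z N Y \<longleftrightarrow>
     0 < r \<and> 0 < levy_density \<psi> r z \<and>
     prob_space N \<and>
     (\<forall>t\<ge>0. Y t \<in> borel_measurable N) \<and>
     (\<forall>\<omega>\<in>space N. cadlag (\<lambda>t. Y t \<omega>)) \<and>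
     (AE \<omega> in N. Y 0 \<omega> = 0) \<and>
     (AE \<omega> in N. \<forall>t\<ge>r. Y t \<omega> = z) \<and>
     (\<forall>(n::nat) (t::nat \<Rightarrow> real).
        1 \<le> n \<and> t 0 = 0 \<and> (\<forall>i<n. t i < t (Suc i)) \<and> t n < r \<longrightarrow>
        distributed N (\<Pi>\<^sub>M i\<in>{1..n}. lborel) (\<lambda>\<omega>. \<lambda>i\<in>{1..n}. Y (t i) \<omega>)
          (\<lambda>x. let x = x(0 := 0) in
             ennreal (levy_density \<psi> (r - t n) (z - x n) / levy_density \<psi> r z *
               (\<Prod>i=1..n. levy_density \<psi> (t i - t (i - 1)) (x i - x (i - 1))))))"

text \<open>
  The set of admissible end points.  The requirement \<open>f\<^sub>r(z) < \<infinity>\<close> is void, since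
  \<^const>\<open>levy_density\<close> is real-valued.
\<close>

definition bridge_endpoints :: "'a measure \<Rightarrow> (real \<Rightarrow> real) \<Rightarrow> ('a \<Rightarrow> real) \<Rightarrow> real set" where
  "bridge_endpoints M \<psi> \<tau> = {z. AE r in distr M borel \<tau>. 0 < levy_density \<psi> r z}"

text \<open>
  A measure on \<^const>\<open>skorohod_space\<close> is the law of \<open>X\<^sup>r\<^sup>,\<^sup>z\<close> iff the coordinate process is a
  version of \<open>X\<^sup>r\<^sup>,\<^sup>z\<close> under it.
\<close>

definition random_length_bridge ::
  "'a measure \<Rightarrow> (real \<Rightarrow> real) \<Rightarrow> ('a \<Rightarrow> real) \<Rightarrow> real \<Rightarrow> (real \<Rightarrow> 'a \<Rightarrow> real) \<Rightarrow> bool"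
where
  "random_length_bridge M \<psi> \<tau> z \<zeta> \<longleftrightarrow>
     (\<forall>t\<ge>0. \<zeta> t \<in> borel_measurable M) \<and>
     (\<forall>\<omega>\<in>space M. cadlag (\<lambda>t. \<zeta> t \<omega>)) \<and>
     (\<exists>Q. cond_distribution M borel \<tau> skorohod_space (\<lambda>\<omega>. \<lambda>t\<in>{0..}. \<zeta> t \<omega>) Q \<and>
          (AE r in distr M borel \<tau>. levy_bridge \<psi> r z (Q r) (\<lambda>t w. w t)))"

section \<open>Markov property and transition law\<close>

definition natural_filtration :: "'a measure \<Rightarrow> (real \<Rightarrow> 'a \<Rightarrow> real) \<Rightarrow> real \<Rightarrow> 'a measure" where
  "natural_filtration M Y t =
     sigma (space M) {Y s -` A \<inter> space M | s A. 0 \<le> s \<and> s \<le> t \<and> A \<in> sets borel}"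

definition markov_process ::
  "'a measure \<Rightarrow> (real \<Rightarrow> 'a measure) \<Rightarrow> (real \<Rightarrow> 'a \<Rightarrow> real) \<Rightarrow> bool"
where
  "markov_process M F Y \<longleftrightarrow>
     (\<forall>t u. \<forall>g::real \<Rightarrow> real.
        0 \<le> t \<and> t < u \<and> g \<in> borel_measurable borel \<and> integrable M (\<lambda>\<omega>. g (Y u \<omega>)) \<longrightarrow>
        (AE \<omega> in M. real_cond_exp M (F t) (\<lambda>\<omega>. g (Y u \<omega>)) \<omega> =
           real_cond_exp M (vimage_algebra (space M) (Y t) borel) (\<lambda>\<omega>. g (Y u \<omega>)) \<omega>))"

definition bridge_phi :: "(real \<Rightarrow> real) \<Rightarrow> real \<Rightarrow> real \<Rightarrow> real \<Rightarrow> real \<Rightarrow> real" where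
  "bridge_phi \<psi> z r t x =
     levy_density \<psi> (r - t) (z - x) / levy_density \<psi> r z * indicator {t<..} r"

text \<open>The measure \<open>\<delta>\<^sub>z + \<lambda>\<close>.\<close>

definition dirac_plus_lebesgue :: "real \<Rightarrow> real measure" where
  "dirac_plus_lebesgue z =
     measure_of UNIV (sets borel) (\<lambda>A. emeasure (return borel z) A + emeasure lborel A)"

lemma sets_dirac_plus_lebesgue [simp]: "sets (dirac_plus_lebesgue z) = sets borel"
  using sets.sigma_sets_eq[of "borel :: real measure"]
  by (simp add: dirac_plus_lebesgue_def sets_measure_of_conv)

lemma emeasure_dirac_plus_lebesgue:
  assumes "A \<in> sets borel"
  shows "emeasure (dirac_plus_lebesgue z) A = indicator A z + emeasure lborel A"
proof -
  let ?\<mu> = "\<lambda>A. emeasure (return borel z) A + emeasure lborel A"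
  have "countably_additive (sets (borel :: real measure)) ?\<mu>"
  proof (unfold countably_additive_def, intro allI impI)
    fix B :: "nat \<Rightarrow> real set"
    assume B: "range B \<subseteq> sets borel" "disjoint_family B"
    have "(\<Sum>i. ?\<mu> (B i)) = (\<Sum>i. emeasure (return borel z) (B i)) + (\<Sum>i. emeasure lborel (B i))"
      by (intro suminf_add[symmetric]) auto
    also have "\<dots> = ?\<mu> (\<Union>i. B i)"
      using B by (subst (1 2) suminf_emeasure) auto
    finally show "(\<Sum>i. ?\<mu> (B i)) = ?\<mu> (\<Union>i. B i)" .
  qed
  moreover have "positive (sets (borel :: real measure)) ?\<mu>"
    by (simp add: positive_def)
  moreover have "sigma_algebra UNIV (sets (borel :: real measure))"
    using sets.sigma_algebra_axioms[of "borel :: real measure"] by simp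
  ultimately have "emeasure (dirac_plus_lebesgue z) A = ?\<mu> A"
    using assms unfolding dirac_plus_lebesgue_def by (intro emeasure_measure_of_sigma)
  then show ?thesis
    using assms by simp
qed

text \<open>
  The factor in brackets in the transition law.  It is \<^typ>\<open>ennreal\<close>-valued, and
  \<open>\<infinity> * 0 = 0\<close> there, so a summand with a vanishing indicator is \<open>0\<close> whatever the value
  of the quotient.
\<close>

definition bridge_transition_density ::
  "(real \<Rightarrow> real) \<Rightarrow> real measure \<Rightarrow> real \<Rightarrow> real \<Rightarrow> real \<Rightarrow> real \<Rightarrow> real \<Rightarrow> ennreal"
where
  "bridge_transition_density \<psi> P\<tau> z t u x y =
     (let D = (\<integral>\<^sup>+ s\<in>{t<..}. ennreal (bridge_phi \<psi> z s t x) \<partial>P\<tau>) in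
       indicator {z} x * indicator {z} y
       + (\<integral>\<^sup>+ r\<in>{t<..u}. (ennreal (bridge_phi \<psi> z r t x) / D) \<partial>P\<tau>)
           * indicator (- {z}) x * indicator {z} y
       + ennreal (levy_density \<psi> (u - t) (y - x))
           * (\<integral>\<^sup>+ r\<in>{u<..}. (ennreal (bridge_phi \<psi> z r u y) / D) \<partial>P\<tau>)
           * indicator (- {z}) x * indicator (- {z}) y)"

text \<open>
  For \<open>z = 0\<close> and \<open>t = 0\<close> this is not the conditional law of \<open>\<zeta>\<^sub>u\<close> given \<open>\<zeta>\<^sub>t\<close>: as
  \<open>\<zeta>\<^sub>0 = 0 = z\<close>, it is \<open>\<delta>\<^sub>z\<close>, but \<open>\<zeta>\<^sub>u\<close> is almost surely different from \<open>z\<close> on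
  \<open>{u < \<tau>}\<close>.  In all other cases with \<open>0 \<le> t < u\<close>, the event \<open>{\<zeta>\<^sub>t = z}\<close> agrees with
  \<open>{\<tau> \<le> t}\<close> up to a null set.
\<close>

definition bridge_transition ::
  "(real \<Rightarrow> real) \<Rightarrow> real measure \<Rightarrow> real \<Rightarrow> real \<Rightarrow> real \<Rightarrow> real \<Rightarrow> real measure"
where
  "bridge_transition \<psi> P\<tau> z t u x =
     density (dirac_plus_lebesgue z) (bridge_transition_density \<psi> P\<tau> z t u x)"

end

theory Submission
  imports Defs
begin

text \<open>
  Given the length \<open>\<tau> = r\<close>, the bridge is the Levy process reweighted by
  \<open>f\<^sub>r\<^sub>-\<^sub>t(z - x) / f\<^sub>r(z)\<close>, and this weight depends on the past up to \<open>t < r\<close> through the last position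
  \<open>x\<close> only.  Integrating over \<open>r\<close> keeps this structure: on \<open>{\<tau> > t}\<close> the positions at times
  \<open>0 < t\<^sub>1 < \<dots> < t\<^sub>n = t\<close> have the density \<open>p(x\<^sub>1, \<dots>, x\<^sub>n) D(x\<^sub>n)\<close>, where \<open>p\<close> is the product of the Levy
  transition densities and \<open>D(x)\<close> is the integral of \<open>\<phi>(\<cdot>, t, x)\<close> over \<open>(t, \<infinity>)\<close>
  (lemma \<open>nn_integral_observation\<close>).  On \<open>{\<tau> \<le> t}\<close> the bridge sits at \<open>z\<close>, and on
  \<open>{\<tau> > t}\<close> it is almost surely not at \<open>z\<close>, so the present position reveals whether the end has been
  reached.  Comparing the density of the positions up to \<open>t\<close> with the densities obtained by adding a
  position at time \<open>u\<close>, on \<open>{t < \<tau> \<le> u}\<close> and on \<open>{u < \<tau>}\<close>, the common factor \<open>p\<close> cancels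
  and the claimed transition kernel remains (lemma \<open>transition\<close>).

  Dividing by \<open>D\<close> is legitimate where \<open>0 < D < \<infinity>\<close>.  Elsewhere both sides vanish almost everywhere:
  \<open>p D\<close> integrates to a probability, so \<open>D = \<infinity>\<close> forces \<open>p = 0\<close>; and survival beyond \<open>u\<close> implies survival
  beyond \<open>t\<close>, so \<open>D = 0\<close> kills the terms belonging to time \<open>u\<close> as well.

  The identity for finitely many times extends to the whole past by uniqueness of finite measures on an
  infinite product, and yields \<open>E[g(\<zeta>\<^sub>u) | F\<^sub>t]\<close> as a function of \<open>\<zeta>\<^sub>t\<close>, which is the
  Markov property together with the transition law.  If \<open>t = 0\<close> and \<open>z = 0\<close>, the position \<open>z\<close> does
  not reveal whether the end has been reached; but then \<open>F\<^sub>0 = \<sigma>(\<zeta>\<^sub>0)\<close> and the Markov property is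
  trivial.

  Products of the numbers \<open>f\<^sub>t(x)\<close> are turned into products of extended nonnegative reals throughout,
  so the formula defining \<open>f\<close> has to be shown nonnegative (lemma \<open>levy_density_nonneg\<close>).
\<close>

section \<open>The density of a Levy process\<close>

text \<open>
  The Fourier integral is damped by the Gaussian factor \<open>n(y / s)\<close>, where \<open>n\<close> is the standard normal
  density.  By Fubini, the damped integral is \<open>s\<close> times the \<open>\<mu>\<close>-mean of the normal characteristic
  function at \<open>(x + a) s\<close>, hence nonnegative; dominated convergence for \<open>s \<rightarrow> \<infinity>\<close> removes the factor.
\<close>

lemma Re_char_inversion_nonneg:
  assumes "real_distribution \<mu>" and int: "integrable lborel (char \<mu>)"
  shows "0 \<le> Re (CLINT y|lborel. iexp (x * y) * char \<mu> y)"
proof -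
  interpret \<mu>: real_distribution \<mu> by fact
  let ?N = "std_normal_distribution"
  interpret N: real_distribution ?N by (rule real_dist_normal_dist)
  interpret P: pair_prob_space ?N \<mu> ..
  have [measurable]: "char \<mu> \<in> borel_measurable borel" by (rule \<mu>.char_measurable)
  let ?h = "\<lambda>y. iexp (x * y) * char \<mu> y"
  have nonneg: "0 \<le> Re (CLINT y|lborel. std_normal_density (y / s) *\<^sub>R ?h y)" if "s > 0" for s
  proof -
    \<comment> \<open>Substitute \<open>y = s w\<close>, so that the damping factor becomes a fixed normal law.\<close>
    have "(CLINT y|lborel. std_normal_density (y / s) *\<^sub>R ?h y)
        = s *\<^sub>R (CLINT w|lborel. std_normal_density w *\<^sub>R ?h (s * w))"
      using that by (subst lborel_integral_real_affine[where c=s and t=0]) auto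
    also have "(CLINT w|lborel. std_normal_density w *\<^sub>R ?h (s * w)) = (CLINT w|?N. ?h (s * w))"
      by (subst integral_density) auto
    also have "\<dots> = (CLINT w|?N. (CLINT a|\<mu>. iexp (((x + a) * s) * w)))"
    proof (rule Bochner_Integration.integral_cong[OF refl])
      fix w
      show "?h (s * w) = (CLINT a|\<mu>. iexp (((x + a) * s) * w))"
        unfolding char_def
        by (subst integral_mult_right_zero[symmetric])
           (auto intro!: Bochner_Integration.integral_cong simp: exp_add[symmetric] algebra_simps)
    qed
    also have "\<dots> = (CLINT a|\<mu>. (CLINT w|?N. iexp (((x + a) * s) * w)))"
      by (intro P.Fubini_integral[symmetric] P.integrable_const_bound[where B=1]) auto
    also have "\<dots> = (CLINT a|\<mu>. complex_of_real (exp (- (((x + a) * s)\<^sup>2) / 2)))"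
      by (simp only: char_std_normal_distribution[unfolded char_def, THEN fun_cong])
    also have "\<dots> = complex_of_real (LINT a|\<mu>. exp (- (((x + a) * s)\<^sup>2) / 2))"
      by (rule integral_complex_of_real)
    finally show ?thesis
      using that by (auto intro!: mult_nonneg_nonneg)
  qed
  have "((\<lambda>s. CLINT y|lborel. std_normal_density (y / s) *\<^sub>R ?h y)
      \<longlongrightarrow> (CLINT y|lborel. std_normal_density 0 *\<^sub>R ?h y)) at_top"
  proof (rule integral_dominated_convergence_at_top[where w = "\<lambda>y. norm (char \<mu> y)"])
    show "AE y in lborel. ((\<lambda>s. std_normal_density (y / s) *\<^sub>R ?h y) \<longlongrightarrow> std_normal_density 0 *\<^sub>R ?h y) at_top"
    proof (rule AE_I2)
      fix y :: real
      have "((\<lambda>s. y / s) \<longlongrightarrow> 0) at_top"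
        by (rule real_tendsto_divide_at_top[OF tendsto_const filterlim_ident])
      then show "((\<lambda>s. std_normal_density (y / s) *\<^sub>R ?h y) \<longlongrightarrow> std_normal_density 0 *\<^sub>R ?h y) at_top"
        unfolding normal_density_def by (intro tendsto_intros) auto
    qed
    have le: "std_normal_density v \<le> 1" for v
    proof -
      have "1 \<le> sqrt (2 * pi)" using pi_ge_two by auto
      moreover have "exp (- v\<^sup>2 / 2) \<le> 1" by simp
      ultimately show ?thesis
        unfolding std_normal_density_def by (intro mult_le_one) (auto simp: divide_le_eq)
    qed
    then show "\<forall>\<^sub>F s in at_top. AE y in lborel. norm (std_normal_density (y / s) *\<^sub>R ?h y) \<le> norm (char \<mu> y)"
      by (auto simp: norm_mult intro!: mult_left_le_one_le always_eventually)
  qed (use int in auto)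
  then have lim: "((\<lambda>s. Re (CLINT y|lborel. std_normal_density (y / s) *\<^sub>R ?h y))
      \<longlongrightarrow> Re (CLINT y|lborel. std_normal_density 0 *\<^sub>R ?h y)) at_top"
    by (rule tendsto_Re)
  have "0 \<le> Re (CLINT y|lborel. std_normal_density 0 *\<^sub>R ?h y)"
  proof (rule tendsto_lowerbound[OF lim])
    show "\<forall>\<^sub>F s in at_top. 0 \<le> Re (CLINT y|lborel. std_normal_density (y / s) *\<^sub>R ?h y)"
      using eventually_gt_at_top[of "0::real"] by eventually_elim (rule nonneg)
  qed simp
  then show ?thesis
    using pi_gt_zero by (simp add: std_normal_density_def zero_le_divide_iff)
qed

lemma levy_density_nonneg:
  assumes "levy_process M X" and "characteristic_exponent M X \<psi>"
    and "integrable lborel (\<lambda>u. exp (t * \<psi> u))" and "0 < t"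
  shows "0 \<le> levy_density \<psi> t x"
proof -
  interpret M: prob_space M using assms by (auto simp: levy_process_def)
  have [measurable]: "X t \<in> borel_measurable M" using assms by (auto simp: levy_process_def)
  have c: "char (distr M borel (X t)) = (\<lambda>u. exp (complex_of_real (t * \<psi> u)))"
    using assms by (auto simp: characteristic_exponent_def)
  have "integrable lborel (\<lambda>u. complex_of_real (exp (t * \<psi> u)))"
    using assms(3) by (rule integrable_of_real)
  then have "integrable lborel (char (distr M borel (X t)))"
    by (simp only: c exp_of_real)
  from Re_char_inversion_nonneg[OF _ this, of x]
  have "0 \<le> Re (CLINT y|lborel. iexp (x * y) * exp (complex_of_real (t * \<psi> y)))"
    by (simp only: c) simp
  then show ?thesis
    unfolding levy_density_def by simp
qed

lemma borel_measurable_levy_density: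
  assumes [measurable]: "\<psi> \<in> borel_measurable borel"
  shows "(\<lambda>p. levy_density \<psi> (fst p) (snd p)) \<in> borel_measurable (borel \<Otimes>\<^sub>M borel)"
  unfolding levy_density_def by measurable

lemma borel_measurable_levy_density_compose [measurable (raw)]:
  assumes "\<psi> \<in> borel_measurable borel"
    and [measurable]: "f \<in> borel_measurable N" "g \<in> borel_measurable N"
  shows "(\<lambda>\<omega>. levy_density \<psi> (f \<omega>) (g \<omega>)) \<in> borel_measurable N"
  using measurable_compose[OF _ borel_measurable_levy_density[OF assms(1)], of "\<lambda>\<omega>. (f \<omega>, g \<omega>)" N]
  by simp

section \<open>Finite time grids\<close>

text \<open>
  The index sets \<open>{1..n}\<close> should keep this form under simplification.
\<close>

declare One_nat_def [simp del]

text \<open>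
  The convention \<open>x\<^sub>0 = 0\<close> for the coordinates \<open>x\<^sub>1, \<dots>, x\<^sub>n\<close>.  It makes the position at the last time
  of a grid meaningful also for \<open>n = 0\<close>, so that transitions from time \<open>0\<close> are those from the empty grid.
\<close>

definition position :: "(nat \<Rightarrow> real) \<Rightarrow> nat \<Rightarrow> real" where
  "position x = x(0 := 0)"

lemma position_0 [simp]: "position x 0 = 0"
  and position_Suc [simp]: "position x (Suc i) = x (Suc i)"
  by (simp_all add: position_def)

lemma measurable_position:
  "i \<le> n \<Longrightarrow> (\<lambda>x. position x i) \<in> borel_measurable (\<Pi>\<^sub>M i\<in>{1..n}. lborel)"
  using measurable_component_singleton[of i "{1..n}" "\<lambda>_. lborel :: real measure"]
  by (cases i) auto

text \<open>
  The hyperplane \<open>x\<^sub>i = z\<close> is a box one side of which has measure \<open>0\<close>.  The index \<open>0\<close> is where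
  \<open>z = 0\<close> has to be excluded.
\<close>

lemma AE_position_neq:
  assumes "i \<le> n" "i = 0 \<Longrightarrow> z \<noteq> 0"
  shows "AE x in (\<Pi>\<^sub>M i\<in>{1..n}. lborel). position x i \<noteq> z"
proof (cases i)
  case 0
  then show ?thesis using assms by simp
next
  case (Suc j)
  interpret product_sigma_finite "\<lambda>_::nat. lborel :: real measure" ..
  let ?N = "\<Pi>\<^sub>E k\<in>{1..n}. if k = i then {z} else UNIV :: real set"
  have "emeasure (\<Pi>\<^sub>M i\<in>{1..n}. lborel) ?N = (\<Prod>k\<in>{1..n}. emeasure lborel (if k = i then {z} else UNIV))"
    by (rule emeasure_PiM) auto
  also have "\<dots> = 0"
    using Suc assms by (intro prod_zero bexI[of _ i]) auto
  finally have "emeasure (\<Pi>\<^sub>M i\<in>{1..n}. lborel) ?N = 0" .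
  moreover have "?N \<in> sets (\<Pi>\<^sub>M i\<in>{1..n}. lborel)"
    by (rule sets_PiM_I_finite) auto
  moreover have "{x \<in> space (\<Pi>\<^sub>M i\<in>{1..n}. lborel). \<not> position x i \<noteq> z} \<subseteq> ?N"
    using Suc by (auto simp: space_PiM PiE_iff extensional_def)
  ultimately show ?thesis
    by (intro AE_I)
qed

definition grid :: "(nat \<Rightarrow> real) \<Rightarrow> nat \<Rightarrow> bool" where
  "grid T n \<longleftrightarrow> T 0 = 0 \<and> (\<forall>i<n. T i < T (Suc i))"

lemma grid_nonneg: "grid T n \<Longrightarrow> i \<le> n \<Longrightarrow> 0 \<le> T i"
  by (induction i) (auto simp: grid_def less_imp_le order.trans Suc_le_eq)

lemma grid_snoc: "grid T n \<Longrightarrow> T n < u \<Longrightarrow> grid (T(Suc n := u)) (Suc n)"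
  by (auto simp: grid_def less_Suc_eq)

text \<open>
  Sorting the set: its largest element becomes the last grid point.
\<close>

lemma grid_of_finite_set:
  assumes "finite J" "J \<subseteq> {0<..}"
  shows "\<exists>T n. grid T n \<and> T ` {1..n} = J"
  using assms
proof (induction rule: finite_linorder_max_induct)
  case empty
  have "grid (\<lambda>_. 0) 0" by (simp add: grid_def)
  then show ?case by (intro exI[of _ "\<lambda>_. 0"] exI[of _ 0]) simp
next
  case (insert b A)
  then obtain T n where T: "grid T n" "T ` {1..n} = A" by auto
  have "T n < b"
  proof (cases n)
    case 0
    then show ?thesis using T insert.prems by (simp add: grid_def)
  next
    case (Suc m)
    then have "T n \<in> A" using T(2) by auto
    then show ?thesis using insert.hyps by auto
  qed
  then have "grid (T(Suc n := b)) (Suc n)" by (rule grid_snoc[OF T(1)])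
  moreover have "{1..Suc n} = insert (Suc n) {1..n}" by auto
  then have "(T(Suc n := b)) ` {1..Suc n} = insert b A" using T(2) by (auto simp: image_def)
  ultimately show ?case by blast
qed

text \<open>
  A cylinder event of the past up to \<open>t\<close> involves arbitrary times in \<open>[0, t]\<close>.  To compare it with the
  finite-dimensional densities of the bridge, these times are put on a grid whose last point is \<open>t\<close>.
\<close>

lemma grid_ending_at:
  assumes J: "finite J" "J \<subseteq> {0..t}" and "0 \<le> t"
  obtains T n where "grid T n" "T n = t" "J \<subseteq> T ` {..n}"
proof (cases "t = 0")
  case True
  with J have "grid (\<lambda>_. 0) 0" "J \<subseteq> (\<lambda>_. 0) ` {..0::nat}" by (auto simp: grid_def)
  with True show ?thesis using that[of "\<lambda>_. 0" 0] by simp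
next
  case False
  have "finite (J - {0, t})" "J - {0, t} \<subseteq> {0<..}" using J by auto
  from grid_of_finite_set[OF this] obtain T n where T: "grid T n" "T ` {1..n} = J - {0, t}" by blast
  have "T n < t"
  proof (cases n)
    case 0
    then show ?thesis using T False \<open>0 \<le> t\<close> by (simp add: grid_def)
  next
    case (Suc m)
    then have "T n \<in> J - {0, t}" unfolding T(2)[symmetric] by auto
    then show ?thesis using J(2) by auto
  qed
  then have "grid (T(Suc n := t)) (Suc n)" by (rule grid_snoc[OF T(1)])
  moreover have "J \<subseteq> (T(Suc n := t)) ` {..Suc n}"
  proof
    fix s assume "s \<in> J"
    then consider "s = 0" | "s = t" | "s \<in> T ` {1..n}" using T(2) by auto
    then show "s \<in> (T(Suc n := t)) ` {..Suc n}"
    proof cases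
      case 1
      then show ?thesis using T(1) by (intro image_eqI[of _ _ 0]) (auto simp: grid_def)
    next
      case 2
      then show ?thesis by (intro image_eqI[of _ _ "Suc n"]) auto
    next
      case 3
      then obtain i where "i \<in> {1..n}" "s = T i" by auto
      then show ?thesis by (intro image_eqI[of _ _ i]) auto
    qed
  qed
  ultimately show ?thesis using that[of "T(Suc n := t)" "Suc n"] by simp
qed

section \<open>Auxiliary measure theory\<close>

lemma nn_integral_dirac_plus_lebesgue:
  assumes "g \<in> borel_measurable borel"
  shows "(\<integral>\<^sup>+ y. g y \<partial>dirac_plus_lebesgue z) = g z + (\<integral>\<^sup>+ y. g y \<partial>lborel)"
  using assms
proof (induction rule: borel_measurable_induct)
  case (cong f g)
  then show ?case by (simp add: space_borel fun_eq_iff cong: nn_integral_cong)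
next
  case (set A)
  then show ?case by (simp add: emeasure_dirac_plus_lebesgue)
next
  case (mult u c)
  then show ?case
    by (simp add: nn_integral_cmult distrib_left measurable_cong_sets[OF sets_dirac_plus_lebesgue refl])
next
  case (add u v)
  then show ?case
    by (simp add: nn_integral_add measurable_cong_sets[OF sets_dirac_plus_lebesgue refl] ac_simps)
next
  case (seq U)
  have "(\<integral>\<^sup>+ y. (SUP i. U i) y \<partial>dirac_plus_lebesgue z) = (SUP i. \<integral>\<^sup>+ y. U i y \<partial>dirac_plus_lebesgue z)"
    using seq by (simp add: image_comp nn_integral_monotone_convergence_SUP
        measurable_cong_sets[OF sets_dirac_plus_lebesgue refl])
  also have "\<dots> = (SUP i. U i z + (\<integral>\<^sup>+ y. U i y \<partial>lborel))"
    by (simp only: seq.IH)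
  also have "\<dots> = (SUP i. U i z) + (SUP i. \<integral>\<^sup>+ y. U i y \<partial>lborel)"
    using seq.hyps by (intro ennreal_SUP_add)
      (auto simp: incseq_def le_fun_def intro!: nn_integral_mono)
  also have "(SUP i. \<integral>\<^sup>+ y. U i y \<partial>lborel) = (\<integral>\<^sup>+ y. (SUP i. U i) y \<partial>lborel)"
    using seq by (simp add: image_comp nn_integral_monotone_convergence_SUP)
  finally show ?case by (simp add: image_comp)
qed

lemma emeasure_distr_density:
  assumes [measurable]: "H \<in> borel_measurable M" "p \<in> measurable M N" "E \<in> sets N"
  shows "emeasure (distr (density M H) N p) E = (\<integral>\<^sup>+ \<omega>. indicator E (p \<omega>) * H \<omega> \<partial>M)"
proof -
  have "emeasure (distr (density M H) N p) E = emeasure (density M H) (p -` E \<inter> space M)"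
    by (subst emeasure_distr) simp_all
  also have "\<dots> = (\<integral>\<^sup>+ \<omega>\<in>p -` E \<inter> space M. H \<omega> \<partial>M)"
    by (rule emeasure_density) measurable
  also have "\<dots> = (\<integral>\<^sup>+ \<omega>. indicator E (p \<omega>) * H \<omega> \<partial>M)"
    by (intro nn_integral_cong) (auto simp: indicator_def)
  finally show ?thesis .
qed

lemma prod_indicator_eq:
  "finite J \<Longrightarrow> (\<Prod>s\<in>J. indicator (A s) (v s) :: ennreal) = (if \<forall>s\<in>J. v s \<in> A s then 1 else 0)"
  by (induction rule: finite_induct) (auto simp: indicator_def)

section \<open>Finite-dimensional laws of the bridge\<close>

text \<open>
  The law of the bridge depends on the Levy process only through the exponent \<open>\<psi>\<close>; that \<open>\<psi>\<close> is the
  exponent of a process shows in the nonnegativity of the densities.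
\<close>

locale random_bridge = prob_space M
  for M :: "'a measure" +
  fixes \<psi> :: "real \<Rightarrow> real" and \<tau> :: "'a \<Rightarrow> real" and z :: real
    and \<zeta> :: "real \<Rightarrow> 'a \<Rightarrow> real" and Q :: "real \<Rightarrow> (real \<Rightarrow> real) measure"
  assumes exponent_measurable [measurable]: "\<psi> \<in> borel_measurable borel"
    and density_nonneg: "\<And>t x. 0 < t \<Longrightarrow> 0 \<le> levy_density \<psi> t x"
    and length_measurable [measurable]: "\<tau> \<in> borel_measurable M"
    and bridge_measurable [measurable]: "\<And>t. 0 \<le> t \<Longrightarrow> \<zeta> t \<in> borel_measurable M"
    and disintegration:
      "cond_distribution M borel \<tau> skorohod_space (\<lambda>\<omega>. \<lambda>t\<in>{0..}. \<zeta> t \<omega>) Q"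
    and bridge_kernel: "AE r in distr M borel \<tau>. levy_bridge \<psi> r z (Q r) (\<lambda>t w. w t)"
begin

abbreviation f :: "real \<Rightarrow> real \<Rightarrow> real" where "f \<equiv> levy_density \<psi>"

abbreviation P :: "real measure" where "P \<equiv> distr M borel \<tau>"

sublocale P: prob_space P
  by (rule prob_space_distr) simp

abbreviation path :: "'a \<Rightarrow> real \<Rightarrow> real" where "path \<omega> \<equiv> (\<lambda>t\<in>{0..}. \<zeta> t \<omega>)"

abbreviation grid_lebesgue :: "nat \<Rightarrow> (nat \<Rightarrow> real) measure" where "grid_lebesgue n \<equiv> \<Pi>\<^sub>M i\<in>{1..n}. lborel"

definition observation :: "(nat \<Rightarrow> real) \<Rightarrow> nat \<Rightarrow> 'a \<Rightarrow> nat \<Rightarrow> real" where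
  "observation T n \<omega> = (\<lambda>i\<in>{1..n}. \<zeta> (T i) \<omega>)"

definition walk_density :: "(nat \<Rightarrow> real) \<Rightarrow> nat \<Rightarrow> (nat \<Rightarrow> real) \<Rightarrow> ennreal" where
  "walk_density T n x = (\<Prod>i=1..n. ennreal (f (T i - T (i - 1)) (position x i - position x (i - 1))))"

text \<open>
  For \<open>C \<subseteq> (t, \<infinity>)\<close> this is the factor by which the weight of a position \<open>x\<close> at time \<open>t\<close> changes when the
  Levy process is replaced by the bridge and the event \<open>{\<tau> \<in> C}\<close> is added.  With \<open>C = (t, \<infinity>)\<close> it is
  the denominator in the transition law.
\<close>

definition phi_integral :: "real \<Rightarrow> real set \<Rightarrow> real \<Rightarrow> ennreal" where
  "phi_integral t C x = (\<integral>\<^sup>+ r\<in>C. ennreal (bridge_phi \<psi> z r t x) \<partial>P)"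

lemma phi_measurable [measurable (raw)]:
  assumes [measurable]: "g \<in> borel_measurable N" "h \<in> borel_measurable N"
  shows "(\<lambda>x. bridge_phi \<psi> z (g x) t (h x)) \<in> borel_measurable N"
  unfolding bridge_phi_def by measurable

lemma phi_integral_measurable [measurable (raw)]:
  assumes [measurable]: "C \<in> sets borel" "h \<in> borel_measurable N"
  shows "(\<lambda>x. phi_integral t C (h x)) \<in> borel_measurable N"
  unfolding phi_integral_def by measurable

lemma endpoint_measurable [measurable]: "(\<lambda>x. position x n) \<in> borel_measurable (grid_lebesgue n)"
  by (rule measurable_position) simp

lemma walk_density_measurable [measurable]: "walk_density T n \<in> borel_measurable (grid_lebesgue n)"
  unfolding walk_density_def
  by (intro borel_measurable_prod_ennreal measurable_compose[OF _ measurable_ennreal]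
    borel_measurable_levy_density_compose borel_measurable_diff measurable_position) auto

lemma observation_measurable [measurable]:
  assumes "grid T n" shows "observation T n \<in> measurable M (grid_lebesgue n)"
  unfolding observation_def using grid_nonneg[OF assms]
  by (intro measurable_restrict) auto

lemma path_measurable: "path \<in> measurable M skorohod_space"
  using disintegration by (simp add: cond_distribution_def)

lemma coordinate_measurable:
  "0 \<le> t \<Longrightarrow> (\<lambda>w. w t) \<in> borel_measurable skorohod_space"
  unfolding skorohod_space_def
  by (intro measurable_restrict_space1 measurable_component_singleton) auto

lemma sets_kernel: "sets (Q r) = sets skorohod_space"
  using disintegration by (simp add: cond_distribution_def)

lemma space_kernel: "space (Q r) = space skorohod_space"
  by (rule sets_eq_imp_space_eq[OF sets_kernel])

lemma kernel_measurable [measurable]: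
  "A \<in> sets skorohod_space \<Longrightarrow> (\<lambda>r. emeasure (Q r) A) \<in> borel_measurable borel"
  using disintegration by (simp add: cond_distribution_def)

lemma emeasure_disintegration:
  "A \<in> sets skorohod_space \<Longrightarrow> B \<in> sets borel \<Longrightarrow>
    emeasure M {\<omega> \<in> space M. \<tau> \<omega> \<in> B \<and> path \<omega> \<in> A} = (\<integral>\<^sup>+ r\<in>B. emeasure (Q r) A \<partial>P)"
  using disintegration by (simp add: cond_distribution_def)

lemma AE_density_pos: "AE r in P. 0 < r \<and> 0 < f r z"
  using bridge_kernel by eventually_elim (simp add: levy_bridge_def)

lemma AE_absorbed:
  assumes "0 \<le> s"
  shows "AE \<omega> in M. \<tau> \<omega> \<le> s \<longrightarrow> \<zeta> s \<omega> = z"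
proof -
  let ?A = "{w \<in> space skorohod_space. w s \<noteq> z}"
  note [measurable] = coordinate_measurable[OF assms]
  have A: "?A \<in> sets skorohod_space" by measurable
  have "emeasure M {\<omega> \<in> space M. \<tau> \<omega> \<in> {..s} \<and> path \<omega> \<in> ?A} = (\<integral>\<^sup>+ r\<in>{..s}. emeasure (Q r) ?A \<partial>P)"
    by (rule emeasure_disintegration[OF A]) simp
  also have "\<dots> = (\<integral>\<^sup>+ r. 0 \<partial>P)"
    using bridge_kernel
  proof (intro nn_integral_cong_AE, eventually_elim)
    fix r assume r: "levy_bridge \<psi> r z (Q r) (\<lambda>t w. w t)"
    show "emeasure (Q r) ?A * indicator {..s} r = 0"
    proof (cases "r \<le> s")
      case True
      have "AE w in Q r. \<forall>t\<ge>r. w t = z" using r by (simp add: levy_bridge_def)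
      then have "AE w in Q r. w s = z" by eventually_elim (use True in auto)
      then have "emeasure (Q r) ?A = 0"
        using AE_iff_measurable[of ?A "Q r" "\<lambda>w. w s = z"] A by (simp add: sets_kernel space_kernel)
      then show ?thesis by simp
    qed simp
  qed
  finally have "emeasure M {\<omega> \<in> space M. \<tau> \<omega> \<in> {..s} \<and> path \<omega> \<in> ?A} = 0" by simp
  moreover have "{\<omega> \<in> space M. \<tau> \<omega> \<in> {..s} \<and> path \<omega> \<in> ?A}
      = {\<omega> \<in> space M. \<not> (\<tau> \<omega> \<le> s \<longrightarrow> \<zeta> s \<omega> = z)}"
    using assms measurable_space[OF path_measurable] by auto
  ultimately show ?thesis
    using assms by (subst AE_iff_measurable[OF _ refl]) auto
qed

lemma AE_start: "AE \<omega> in M. \<zeta> 0 \<omega> = 0"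
proof -
  let ?A = "{w \<in> space skorohod_space. w 0 \<noteq> 0}"
  note [measurable] = coordinate_measurable[of 0, simplified]
  have A: "?A \<in> sets skorohod_space" by measurable
  have "emeasure M {\<omega> \<in> space M. \<tau> \<omega> \<in> UNIV \<and> path \<omega> \<in> ?A} = (\<integral>\<^sup>+ r\<in>UNIV. emeasure (Q r) ?A \<partial>P)"
    by (rule emeasure_disintegration[OF A]) simp
  also have "\<dots> = (\<integral>\<^sup>+ r. 0 \<partial>P)"
    using bridge_kernel
  proof (intro nn_integral_cong_AE, eventually_elim)
    fix r assume r: "levy_bridge \<psi> r z (Q r) (\<lambda>t w. w t)"
    then have "AE w in Q r. w 0 = 0" by (simp add: levy_bridge_def)
    then show "emeasure (Q r) ?A * indicator UNIV r = 0"
      using AE_iff_measurable[of ?A "Q r" "\<lambda>w. w 0 = 0"] A by (simp add: sets_kernel space_kernel)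
  qed
  finally have "emeasure M {\<omega> \<in> space M. \<tau> \<omega> \<in> UNIV \<and> path \<omega> \<in> ?A} = 0" by simp
  moreover have "{\<omega> \<in> space M. \<tau> \<omega> \<in> UNIV \<and> path \<omega> \<in> ?A} = {\<omega> \<in> space M. \<not> \<zeta> 0 \<omega> = 0}"
    using measurable_space[OF path_measurable] by auto
  ultimately show ?thesis
    by (subst AE_iff_measurable[OF _ refl]) auto
qed

lemma AE_observation:
  assumes "grid T n"
  shows "AE \<omega> in M. \<forall>i\<le>n. \<zeta> (T i) \<omega> = position (observation T n \<omega>) i"
  using AE_start
proof eventually_elim
  case (elim \<omega>)
  show ?case
  proof (intro allI impI)
    fix i assume "i \<le> n"
    then show "\<zeta> (T i) \<omega> = position (observation T n \<omega>) i"
      using elim assms by (cases i) (auto simp: observation_def grid_def)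
  qed
qed

text \<open>
  The bridge density of given length, with each factor moved into the extended nonnegative reals; this is
  where nonnegativity of the Levy densities matters.
\<close>

lemma kernel_fdd:
  assumes "grid T n" "1 \<le> n" "T n < r" and S: "S \<in> sets (grid_lebesgue n)"
    and br: "levy_bridge \<psi> r z (Q r) (\<lambda>t w. w t)"
  shows "emeasure (Q r) {w \<in> space skorohod_space. (\<lambda>i\<in>{1..n}. w (T i)) \<in> S} =
    (\<integral>\<^sup>+ x. walk_density T n x * ennreal (bridge_phi \<psi> z r (T n) (position x n)) * indicator S x \<partial>grid_lebesgue n)"
proof -
  have fz: "0 < f r z" using br by (simp add: levy_bridge_def)
  have step: "0 \<le> f (T i - T (i - 1)) y" if "i \<in> {1..n}" for i y
  proof (rule density_nonneg)
    from that obtain j where "i = Suc j" "j < n" by (cases i) auto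
    then show "0 < T i - T (i - 1)" using assms(1) by (auto simp: grid_def)
  qed
  let ?d = "\<lambda>x. ennreal (f (r - T n) (z - position x n) / f r z *
               (\<Prod>i=1..n. f (T i - T (i - 1)) (position x i - position x (i - 1))))"
  have d: "?d x = walk_density T n x * ennreal (bridge_phi \<psi> z r (T n) (position x n))" for x
  proof -
    have "(\<Prod>i=1..n. ennreal (f (T i - T (i - 1)) (position x i - position x (i - 1))))
        = ennreal (\<Prod>i=1..n. f (T i - T (i - 1)) (position x i - position x (i - 1)))"
      by (rule prod_ennreal) (rule step)
    moreover have "0 \<le> (\<Prod>i=1..n. f (T i - T (i - 1)) (position x i - position x (i - 1)))"
      by (rule prod_nonneg) (use step in auto)
    moreover have "0 \<le> f (r - T n) (z - position x n)" using assms(3) by (intro density_nonneg) simp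
    ultimately show ?thesis
      using fz assms(3) unfolding walk_density_def bridge_phi_def
      by (simp add: ennreal_mult[symmetric] ac_simps del: times_divide_eq_left times_divide_eq_right)
  qed
  have "distributed (Q r) (grid_lebesgue n) (\<lambda>w. \<lambda>i\<in>{1..n}. w (T i)) ?d"
    using br[unfolded levy_bridge_def Let_def] assms(1-3) unfolding position_def grid_def by simp
  from distributed_emeasure[OF this S]
  have "emeasure (Q r) ((\<lambda>w. \<lambda>i\<in>{1..n}. w (T i)) -` S \<inter> space (Q r)) = (\<integral>\<^sup>+ x. ?d x * indicator S x \<partial>grid_lebesgue n)" .
  also have "(\<lambda>w. \<lambda>i\<in>{1..n}. w (T i)) -` S \<inter> space (Q r) = {w \<in> space skorohod_space. (\<lambda>i\<in>{1..n}. w (T i)) \<in> S}"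
    by (auto simp: space_kernel)
  finally show ?thesis by (simp only: d)
qed

text \<open>
  Disintegration over the length and Fubini.  For the empty grid, \<open>\<phi>(r, 0, 0) = 1\<close> for almost every length
  \<open>r\<close>, so both sides are the probability of \<open>{\<tau> \<in> C}\<close> or \<open>0\<close>.
\<close>

lemma emeasure_observation:
  assumes T: "grid T n" and C[measurable]: "C \<in> sets borel" and CT: "C \<subseteq> {T n<..}"
    and S[measurable]: "S \<in> sets (grid_lebesgue n)"
  shows "emeasure M {\<omega> \<in> space M. \<tau> \<omega> \<in> C \<and> observation T n \<omega> \<in> S} =
    (\<integral>\<^sup>+ x\<in>S. (walk_density T n x * phi_integral (T n) C (position x n)) \<partial>grid_lebesgue n)"
proof (cases n)
  case 0
  have "phi_integral 0 C 0 = (\<integral>\<^sup>+ r. indicator C r \<partial>P)"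
    unfolding phi_integral_def using AE_density_pos
    by (intro nn_integral_cong_AE, eventually_elim) (auto simp: bridge_phi_def indicator_def)
  also have "\<dots> = emeasure M {\<omega> \<in> space M. \<tau> \<omega> \<in> C}"
    by (simp add: emeasure_distr vimage_def Int_def conj_commute)
  finally have "phi_integral 0 C 0 = \<dots>" .
  then show ?thesis
    using 0 T S by (cases "(\<lambda>_. undefined) \<in> S")
      (simp_all add: PiM_empty nn_integral_count_space_finite walk_density_def observation_def grid_def restrict_def)
next
  case (Suc m)
  interpret L: product_sigma_finite "\<lambda>_::nat. lborel :: real measure" ..
  interpret L: sigma_finite_measure "grid_lebesgue n" by (rule L.sigma_finite) simp
  interpret LP: pair_sigma_finite "grid_lebesgue n" P ..
  let ?A = "{w \<in> space skorohod_space. (\<lambda>i\<in>{1..n}. w (T i)) \<in> S}"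
  have "(\<lambda>w. \<lambda>i\<in>{1..n}. w (T i)) \<in> measurable skorohod_space (grid_lebesgue n)"
    using grid_nonneg[OF T] coordinate_measurable by (intro measurable_restrict) auto
  note [measurable] = this
  have A: "?A \<in> sets skorohod_space" by measurable
  have "{\<omega> \<in> space M. \<tau> \<omega> \<in> C \<and> observation T n \<omega> \<in> S} = {\<omega> \<in> space M. \<tau> \<omega> \<in> C \<and> path \<omega> \<in> ?A}"
  proof -
    have "(\<lambda>i\<in>{1..n}. path \<omega> (T i)) = observation T n \<omega>" for \<omega>
      using grid_nonneg[OF T] by (auto simp: observation_def fun_eq_iff restrict_def)
    then show ?thesis using measurable_space[OF path_measurable] by auto
  qed
  then have "emeasure M {\<omega> \<in> space M. \<tau> \<omega> \<in> C \<and> observation T n \<omega> \<in> S} = (\<integral>\<^sup>+ r\<in>C. emeasure (Q r) ?A \<partial>P)"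
    by (simp only: emeasure_disintegration[OF A C])
  also have "\<dots> = (\<integral>\<^sup>+ r. (\<integral>\<^sup>+ x. walk_density T n x * ennreal (bridge_phi \<psi> z r (T n) (position x n)) *
       indicator S x * indicator C r \<partial>grid_lebesgue n) \<partial>P)"
    using bridge_kernel
  proof (intro nn_integral_cong_AE, eventually_elim)
    fix r assume r: "levy_bridge \<psi> r z (Q r) (\<lambda>t w. w t)"
    show "emeasure (Q r) ?A * indicator C r = (\<integral>\<^sup>+ x. walk_density T n x * ennreal (bridge_phi \<psi> z r (T n) (position x n)) *
       indicator S x * indicator C r \<partial>grid_lebesgue n)"
      using kernel_fdd[OF T _ _ S r] CT Suc by (cases "r \<in> C") auto
  qed
  also have "\<dots> = (\<integral>\<^sup>+ x. (\<integral>\<^sup>+ r. walk_density T n x * ennreal (bridge_phi \<psi> z r (T n) (position x n)) *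
       indicator S x * indicator C r \<partial>P) \<partial>grid_lebesgue n)"
    by (rule LP.Fubini') measurable
  also have "\<dots> = (\<integral>\<^sup>+ x. (\<integral>\<^sup>+ r. walk_density T n x * indicator S x * (ennreal (bridge_phi \<psi> z r (T n) (position x n)) *
       indicator C r) \<partial>P) \<partial>grid_lebesgue n)"
    by (simp add: ac_simps)
  also have "\<dots> = (\<integral>\<^sup>+ x\<in>S. (walk_density T n x * phi_integral (T n) C (position x n)) \<partial>grid_lebesgue n)"
    unfolding phi_integral_def
    by (intro nn_integral_cong) (subst nn_integral_cmult, auto simp: ac_simps)
  finally show ?thesis .
qed

lemma nn_integral_observation:
  assumes T: "grid T n" and C[measurable]: "C \<in> sets borel" and CT: "C \<subseteq> {T n<..}"
    and G[measurable]: "G \<in> borel_measurable (grid_lebesgue n)"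
  shows "(\<integral>\<^sup>+ \<omega>. G (observation T n \<omega>) * indicator C (\<tau> \<omega>) \<partial>M) =
    (\<integral>\<^sup>+ x. G x * (walk_density T n x * phi_integral (T n) C (position x n)) \<partial>grid_lebesgue n)"
proof -
  note [measurable] = observation_measurable[OF T]
  have "distr (density M (\<lambda>\<omega>. indicator C (\<tau> \<omega>))) (grid_lebesgue n) (observation T n) =
      density (grid_lebesgue n) (\<lambda>x. walk_density T n x * phi_integral (T n) C (position x n))" (is "?L = ?R")
  proof (rule measure_eqI)
    fix S assume "S \<in> sets ?L"
    then have S[measurable]: "S \<in> sets (grid_lebesgue n)" by simp
    have "emeasure ?L S = (\<integral>\<^sup>+ \<omega>. indicator S (observation T n \<omega>) * indicator C (\<tau> \<omega>) \<partial>M)"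
      by (rule emeasure_distr_density) measurable
    also have "\<dots> = (\<integral>\<^sup>+\<omega>. indicator {\<omega> \<in> space M. \<tau> \<omega> \<in> C \<and> observation T n \<omega> \<in> S} \<omega> \<partial>M)"
      by (intro nn_integral_cong) (auto simp: indicator_def)
    also have "\<dots> = emeasure M {\<omega> \<in> space M. \<tau> \<omega> \<in> C \<and> observation T n \<omega> \<in> S}"
      by (rule nn_integral_indicator) measurable
    finally show "emeasure ?L S = emeasure ?R S"
      by (simp add: emeasure_observation[OF T C CT S] emeasure_density)
  qed simp
  then have "(\<integral>\<^sup>+ x. G x \<partial>?L) = (\<integral>\<^sup>+ x. G x \<partial>?R)" by simp
  then show ?thesis
    by (simp add: nn_integral_distr nn_integral_density mult.commute)
qed

section \<open>The transition kernel\<close>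

text \<open>
  The unnormalised contribution of \<open>{u < \<tau>}\<close> to the transition from \<open>x\<close> at time \<open>t\<close>; dividing by
  \<open>phi_integral t {t<..} x\<close> gives the third summand of the transition law applied to \<open>g\<close>.
\<close>

definition alive_integral :: "real \<Rightarrow> real \<Rightarrow> (real \<Rightarrow> ennreal) \<Rightarrow> real \<Rightarrow> ennreal" where
  "alive_integral t u g x = (\<integral>\<^sup>+ y. g y * (ennreal (f (u - t) (y - x)) * phi_integral u {u<..} y) \<partial>lborel)"

lemma alive_integral_measurable [measurable (raw)]:
  assumes [measurable]: "g \<in> borel_measurable borel" "h \<in> borel_measurable N"
  shows "(\<lambda>x. alive_integral t u g (h x)) \<in> borel_measurable N"
  unfolding alive_integral_def by measurable

definition transition_integral :: "real \<Rightarrow> real \<Rightarrow> (real \<Rightarrow> ennreal) \<Rightarrow> real \<Rightarrow> ennreal" where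
  "transition_integral t u g x = (\<integral>\<^sup>+ y. g y \<partial>bridge_transition \<psi> P z t u x)"

text \<open>
  The denominator does not depend on the variable of integration and can be taken out of the quotients.
\<close>

lemma transition_density_eq:
  "bridge_transition_density \<psi> P z t u x y =
     indicator {z} x * indicator {z} y
     + phi_integral t {t<..u} x / phi_integral t {t<..} x * indicator (- {z}) x * indicator {z} y
     + ennreal (f (u - t) (y - x)) * (phi_integral u {u<..} y / phi_integral t {t<..} x)
         * indicator (- {z}) x * indicator (- {z}) y"
proof -
  have "(\<integral>\<^sup>+ r\<in>C. (ennreal (bridge_phi \<psi> z r s v) / c) \<partial>P) = phi_integral s C v / c"
    if [measurable]: "C \<in> sets borel" for C s v c
  proof -
    have "(\<integral>\<^sup>+ r\<in>C. (ennreal (bridge_phi \<psi> z r s v) / c) \<partial>P)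
        = (\<integral>\<^sup>+ r. (ennreal (bridge_phi \<psi> z r s v) * indicator C r) / c \<partial>P)"
      by (simp add: divide_ennreal_def ac_simps)
    also have "\<dots> = phi_integral s C v / c"
      unfolding phi_integral_def by (rule nn_integral_divide) measurable
    finally show ?thesis .
  qed
  then show ?thesis
    unfolding bridge_transition_density_def Let_def phi_integral_def[of t "{t<..}" x, symmetric] by simp
qed

lemma transition_density_measurable [measurable]:
  "bridge_transition_density \<psi> P z t u x \<in> borel_measurable borel"
  unfolding transition_density_eq[abs_def] by measurable

lemma transition_integral_eq:
  assumes [measurable]: "g \<in> borel_measurable borel"
  shows "transition_integral t u g x = g z * bridge_transition_density \<psi> P z t u x z
    + (\<integral>\<^sup>+ y. g y * bridge_transition_density \<psi> P z t u x y \<partial>lborel)"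
proof -
  have "transition_integral t u g x = (\<integral>\<^sup>+ y. bridge_transition_density \<psi> P z t u x y * g y \<partial>dirac_plus_lebesgue z)"
    unfolding transition_integral_def bridge_transition_def
    by (rule nn_integral_density) (simp_all add: measurable_cong_sets[OF sets_dirac_plus_lebesgue refl])
  then show ?thesis
    by (simp add: nn_integral_dirac_plus_lebesgue mult.commute)
qed

lemma transition_integral_absorbed:
  assumes [measurable]: "g \<in> borel_measurable borel"
  shows "transition_integral t u g z = g z"
proof -
  have "(\<integral>\<^sup>+ y. g y * bridge_transition_density \<psi> P z t u z y \<partial>lborel) = (\<integral>\<^sup>+ y. 0 \<partial>(lborel :: real measure))"
    by (intro nn_integral_cong_AE eventually_mono[OF AE_lborel_singleton[of z]])
       (simp add: transition_density_eq)
  then show ?thesis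
    by (simp add: transition_integral_eq transition_density_eq)
qed

lemma transition_integral_alive:
  assumes [measurable]: "g \<in> borel_measurable borel" and x: "x \<noteq> z"
  shows "transition_integral t u g x = (g z * phi_integral t {t<..u} x + alive_integral t u g x) / phi_integral t {t<..} x"
proof -
  have "(\<integral>\<^sup>+ y. g y * bridge_transition_density \<psi> P z t u x y \<partial>lborel) =
      (\<integral>\<^sup>+ y. g y * (ennreal (f (u - t) (y - x)) * phi_integral u {u<..} y) / phi_integral t {t<..} x \<partial>lborel)"
    using x by (intro nn_integral_cong_AE eventually_mono[OF AE_lborel_singleton[of z]])
       (simp add: transition_density_eq divide_ennreal_def ac_simps)
  also have "\<dots> = alive_integral t u g x / phi_integral t {t<..} x"
    unfolding alive_integral_def by (rule nn_integral_divide) measurable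
  finally show ?thesis
    using x by (simp add: transition_integral_eq transition_density_eq divide_ennreal_def ring_distribs ac_simps)
qed

lemma transition_integral_measurable [measurable (raw)]:
  assumes [measurable]: "g \<in> borel_measurable borel" "h \<in> borel_measurable N"
  shows "(\<lambda>x. transition_integral t u g (h x)) \<in> borel_measurable N"
proof -
  have "transition_integral t u g = (\<lambda>x. if x = z then g z else (g z * phi_integral t {t<..u} x + alive_integral t u g x) / phi_integral t {t<..} x)"
    by (auto simp: fun_eq_iff transition_integral_absorbed transition_integral_alive)
  then have [measurable]: "transition_integral t u g \<in> borel_measurable borel"
    by simp
  show ?thesis by measurable
qed

lemma walk_density_snoc:
  "walk_density (T(Suc n := u)) (Suc n) (x(Suc n := y)) = walk_density T n x * ennreal (f (u - T n) (y - position x n))"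
proof -
  have p: "position (x(Suc n := y)) i = position x i" if "i \<le> n" for i
    using that by (cases i) auto
  have "{1..Suc n} = insert (Suc n) {1..n}" by auto
  then show ?thesis
    by (auto simp: walk_density_def p mult.commute intro!: arg_cong2[where f="(*)"] prod.cong)
qed

text \<open>
  The grid is extended by the point \<open>u\<close>, and the new coordinate is integrated out first.
\<close>

lemma nn_integral_alive:
  assumes T: "grid T n" "T n < u"
    and g [measurable]: "g \<in> borel_measurable borel"
    and G [measurable]: "G \<in> borel_measurable (grid_lebesgue n)"
  shows "(\<integral>\<^sup>+ \<omega>. G (observation T n \<omega>) * g (\<zeta> u \<omega>) * indicator {u<..} (\<tau> \<omega>) \<partial>M) =
    (\<integral>\<^sup>+ x. G x * (walk_density T n x * alive_integral (T n) u g (position x n)) \<partial>grid_lebesgue n)"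
proof -
  interpret L: product_sigma_finite "\<lambda>_::nat. lborel :: real measure" ..
  let ?T = "T(Suc n := u)"
  let ?H = "\<lambda>x. G (restrict x {1..n}) * g (position x (Suc n))"
  let ?J = "\<lambda>x. ?H x * (walk_density ?T (Suc n) x *
    phi_integral (?T (Suc n)) {u<..} (position x (Suc n)))"
  have T': "grid ?T (Suc n)" using T by (rule grid_snoc)
  have [measurable]: "(\<lambda>x. restrict x {1..n}) \<in> measurable (grid_lebesgue (Suc n)) (grid_lebesgue n)"
    by (rule measurable_restrict_subset) auto
  have [measurable]: "(\<lambda>x. x (Suc n)) \<in> borel_measurable (grid_lebesgue (Suc n))"
    using endpoint_measurable[of "Suc n"] by simp
  have H [measurable]: "?H \<in> borel_measurable (grid_lebesgue (Suc n))"
    by measurable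
  have "observation ?T (Suc n) \<omega> (Suc n) = \<zeta> u \<omega>" "restrict (observation ?T (Suc n) \<omega>) {1..n} = observation T n \<omega>" for \<omega>
    by (auto simp: observation_def fun_eq_iff restrict_def)
  then have "(\<integral>\<^sup>+ \<omega>. G (observation T n \<omega>) * g (\<zeta> u \<omega>) * indicator {u<..} (\<tau> \<omega>) \<partial>M) =
      (\<integral>\<^sup>+ \<omega>. ?H (observation ?T (Suc n) \<omega>) * indicator {u<..} (\<tau> \<omega>) \<partial>M)"
    by simp
  also have "\<dots> = (\<integral>\<^sup>+ x. ?J x \<partial>grid_lebesgue (Suc n))"
    by (rule nn_integral_observation[OF T' _ _ H]) auto
  also have "{1..Suc n} = insert (Suc n) {1..n}" by auto
  also have "(\<integral>\<^sup>+ x. ?J x \<partial>(\<Pi>\<^sub>M i\<in>insert (Suc n) {1..n}. lborel)) =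
      (\<integral>\<^sup>+ x. (\<integral>\<^sup>+ y. ?J (x(Suc n := y)) \<partial>lborel) \<partial>grid_lebesgue n)"
  proof (rule L.product_nn_integral_insert)
    have "{1..Suc n} = insert (Suc n) {1..n}" by auto
    moreover have "?J \<in> borel_measurable (grid_lebesgue (Suc n))"
      by measurable
    ultimately show "?J
      \<in> borel_measurable (\<Pi>\<^sub>M i\<in>insert (Suc n) {1..n}. lborel)" by metis
  qed auto
  also have "\<dots> = (\<integral>\<^sup>+ x. G x * (walk_density T n x * alive_integral (T n) u g (position x n)) \<partial>grid_lebesgue n)"
  proof (rule nn_integral_cong)
    fix x assume "x \<in> space (grid_lebesgue n)"
    then have r: "restrict (x(Suc n := y)) {1..n} = x" for y
      by (auto simp: space_PiM PiE_iff extensional_def fun_eq_iff restrict_def)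
    have "(\<integral>\<^sup>+ y. ?J (x(Suc n := y)) \<partial>lborel)
       = (\<integral>\<^sup>+ y. (G x * walk_density T n x) * (g y * (ennreal (f (u - T n) (y - position x n)) * phi_integral u {u<..} y)) \<partial>lborel)"
      by (simp only: r walk_density_snoc) (simp add: ac_simps)
    also have "\<dots> = G x * (walk_density T n x * alive_integral (T n) u g (position x n))"
      unfolding alive_integral_def by (subst nn_integral_cmult) (auto simp: ac_simps)
    finally show "(\<integral>\<^sup>+ y. ?J (x(Suc n := y)) \<partial>lborel) = G x * (walk_density T n x * alive_integral (T n) u g (position x n))" .
  qed
  finally show ?thesis .
qed

text \<open>
  The function is the density of the positions on \<open>{T n < \<tau>}\<close>, hence integrable.
\<close>

lemma AE_survival_finite:
  assumes T: "grid T n"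
  shows "AE x in grid_lebesgue n. walk_density T n x * phi_integral (T n) {T n<..} (position x n) \<noteq> \<infinity>"
proof (rule nn_integral_noteq_infinite)
  have "(\<integral>\<^sup>+ x. walk_density T n x * phi_integral (T n) {T n<..} (position x n) \<partial>grid_lebesgue n) =
      (\<integral>\<^sup>+ \<omega>. indicator {T n<..} (\<tau> \<omega>) \<partial>M)"
    using nn_integral_observation[OF T, of "{T n<..}" "\<lambda>_. 1"] by simp
  also have "\<dots> \<le> (\<integral>\<^sup>+ \<omega>. 1 \<partial>M)"
    by (intro nn_integral_mono) (simp add: indicator_def)
  also have "\<dots> < \<infinity>"
    by (simp add: emeasure_space_1)
  finally show "(\<integral>\<^sup>+ x. walk_density T n x * phi_integral (T n) {T n<..} (position x n) \<partial>grid_lebesgue n) \<noteq> \<infinity>" by simp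
qed measurable

text \<open>
  The positions \<open>x\<close> with vanishing denominator are almost surely not visited at time \<open>T n\<close> while
  \<open>T n < \<tau>\<close>, and all the more not while \<open>u < \<tau>\<close>.
\<close>

lemma AE_no_survival:
  assumes T: "grid T n" "T n < u" and g [measurable]: "g \<in> borel_measurable borel"
  shows "AE x in grid_lebesgue n. phi_integral (T n) {T n<..} (position x n) = 0 \<longrightarrow> walk_density T n x * alive_integral (T n) u g (position x n) = 0"
proof -
  define G :: "(nat \<Rightarrow> real) \<Rightarrow> ennreal"
    where "G x = indicator {y. phi_integral (T n) {T n<..} y = 0} (position x n)" for x
  have G [measurable]: "G \<in> borel_measurable (grid_lebesgue n)"
    unfolding G_def by measurable
  note [measurable] = observation_measurable[OF T(1)]
  have "(\<integral>\<^sup>+ \<omega>. G (observation T n \<omega>) * indicator {T n<..} (\<tau> \<omega>) \<partial>M) =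
      (\<integral>\<^sup>+ x. G x * (walk_density T n x * phi_integral (T n) {T n<..} (position x n)) \<partial>grid_lebesgue n)"
    by (rule nn_integral_observation[OF T(1) _ _ G]) auto
  also have "\<dots> = (\<integral>\<^sup>+ x. 0 \<partial>grid_lebesgue n)"
    by (intro nn_integral_cong) (simp add: G_def indicator_def)
  finally have "(\<integral>\<^sup>+ \<omega>. G (observation T n \<omega>) * indicator {T n<..} (\<tau> \<omega>) \<partial>M) = 0"
    by simp
  then have "AE \<omega> in M. G (observation T n \<omega>) * indicator {T n<..} (\<tau> \<omega>) = 0"
    by (subst (asm) nn_integral_0_iff_AE) measurable
  then have "AE \<omega> in M. G (observation T n \<omega>) * g (\<zeta> u \<omega>) * indicator {u<..} (\<tau> \<omega>) = 0"
    by eventually_elim (use T(2) in \<open>auto simp: indicator_def split: if_splits\<close>)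
  then have "(\<integral>\<^sup>+ \<omega>. G (observation T n \<omega>) * g (\<zeta> u \<omega>) * indicator {u<..} (\<tau> \<omega>) \<partial>M) = (\<integral>\<^sup>+ \<omega>. 0 \<partial>M)"
    by (rule nn_integral_cong_AE)
  then have "(\<integral>\<^sup>+ x. G x * (walk_density T n x * alive_integral (T n) u g (position x n)) \<partial>grid_lebesgue n) = 0"
    by (simp add: nn_integral_alive[OF T g G])
  then have "AE x in grid_lebesgue n. G x * (walk_density T n x * alive_integral (T n) u g (position x n)) = 0"
    by (subst (asm) nn_integral_0_iff_AE) measurable
  then show ?thesis
    by eventually_elim (auto simp: G_def indicator_def split: if_splits)
qed

text \<open>
  The pointwise form of the transition law, multiplied by the density of the positions on
  \<open>{T n < \<tau>}\<close>.  The points where the denominator cannot be cancelled are covered by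
  \<open>AE_survival_finite\<close> and \<open>AE_no_survival\<close>.
\<close>

lemma AE_transition_identity:
  assumes T: "grid T n" "T n < u" "T n = 0 \<longrightarrow> z \<noteq> 0" and g [measurable]: "g \<in> borel_measurable borel"
  shows "AE x in grid_lebesgue n. transition_integral (T n) u g (position x n) * (walk_density T n x * phi_integral (T n) {T n<..} (position x n)) =
    g z * (walk_density T n x * phi_integral (T n) {T n<..u} (position x n)) + walk_density T n x * alive_integral (T n) u g (position x n)"
proof -
  have "AE x in grid_lebesgue n. position x n \<noteq> z"
    using T by (intro AE_position_neq) (auto simp: grid_def)
  with AE_survival_finite[OF T(1)] AE_no_survival[OF T(1,2) g] show ?thesis
  proof eventually_elim
    case (elim x)
    let ?D = "phi_integral (T n) {T n<..} (position x n)" and ?w = "walk_density T n x"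
    have le: "phi_integral (T n) {T n<..u} (position x n) \<le> ?D"
      unfolding phi_integral_def by (intro nn_integral_mono) (auto simp: indicator_def)
    consider "?w = 0" | "?D = 0" | "?w \<noteq> 0" "?D \<noteq> 0" by blast
    then show ?case
    proof cases
      case 2
      with le have "phi_integral (T n) {T n<..u} (position x n) = 0" by simp
      with 2 elim show ?thesis by simp
    next
      case 3
      then have D: "?D \<noteq> \<infinity>" using elim by (auto simp: ennreal_mult_top)
      have "transition_integral (T n) u g (position x n) * ?D = g z * phi_integral (T n) {T n<..u} (position x n) + alive_integral (T n) u g (position x n)"
        unfolding transition_integral_alive[OF g elim(3)] using 3 D
        by (simp add: ennreal_divide_times less_top)
      then have "?w * (transition_integral (T n) u g (position x n) * ?D) = ?w * (g z * phi_integral (T n) {T n<..u} (position x n) + alive_integral (T n) u g (position x n))"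
        by simp
      then show ?thesis by (simp add: ring_distribs ac_simps)
    qed simp
  qed
qed

text \<open>
  The expectation on the left is split according to \<open>\<tau> \<le> T n\<close>, \<open>T n < \<tau> \<le> u\<close> and \<open>u < \<tau>\<close>.  In
  the first two cases \<open>\<zeta>\<^sub>u = z\<close>.  The last two cases together give the right-hand side on
  \<open>{T n < \<tau>}\<close>; on \<open>{\<tau> \<le> T n}\<close> the kernel is evaluated at \<open>z\<close>, where it is the point mass at \<open>z\<close>.
\<close>

lemma transition:
  assumes T: "grid T n" "T n < u" "T n = 0 \<longrightarrow> z \<noteq> 0"
    and g [measurable]: "g \<in> borel_measurable borel"
    and G [measurable]: "G \<in> borel_measurable (grid_lebesgue n)"
  shows "(\<integral>\<^sup>+ \<omega>. G (observation T n \<omega>) * g (\<zeta> u \<omega>) \<partial>M) =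
    (\<integral>\<^sup>+ \<omega>. G (observation T n \<omega>) * transition_integral (T n) u g (\<zeta> (T n) \<omega>) \<partial>M)"
proof -
  have T0: "0 \<le> T n" using T by (intro grid_nonneg[of T n]) auto
  note [measurable] = observation_measurable[OF T(1)] bridge_measurable[OF T0]
  have u0: "0 \<le> u" using T0 T(2) by simp
  note [measurable] = bridge_measurable[OF u0]
  let ?dead = "\<integral>\<^sup>+ \<omega>. G (observation T n \<omega>) * g z * indicator {..T n} (\<tau> \<omega>) \<partial>M"
  have "(\<integral>\<^sup>+ \<omega>. G (observation T n \<omega>) * g (\<zeta> u \<omega>) \<partial>M) =
      (\<integral>\<^sup>+ \<omega>. (G (observation T n \<omega>) * g z * indicator {..T n} (\<tau> \<omega>)
        + g z * (G (observation T n \<omega>) * indicator {T n<..u} (\<tau> \<omega>)))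
        + G (observation T n \<omega>) * g (\<zeta> u \<omega>) * indicator {u<..} (\<tau> \<omega>) \<partial>M)"
    using AE_absorbed[OF u0]
    by (intro nn_integral_cong_AE, eventually_elim) (use T(2) in \<open>auto simp: indicator_def mult.commute\<close>)
  also have "\<dots> = ?dead + g z * (\<integral>\<^sup>+ \<omega>. G (observation T n \<omega>) * indicator {T n<..u} (\<tau> \<omega>) \<partial>M)
        + (\<integral>\<^sup>+ \<omega>. G (observation T n \<omega>) * g (\<zeta> u \<omega>) * indicator {u<..} (\<tau> \<omega>) \<partial>M)"
    by (simp add: nn_integral_add nn_integral_cmult)
  also have "\<dots> = ?dead + g z * (\<integral>\<^sup>+ x. G x * (walk_density T n x * phi_integral (T n) {T n<..u} (position x n)) \<partial>grid_lebesgue n)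
        + (\<integral>\<^sup>+ x. G x * (walk_density T n x * alive_integral (T n) u g (position x n)) \<partial>grid_lebesgue n)"
    by (subst nn_integral_observation[OF T(1) _ _ G], simp, force, subst nn_integral_alive[OF T(1,2) g G], rule refl)
  also have "\<dots> = ?dead + (\<integral>\<^sup>+ x. G x * (g z * (walk_density T n x * phi_integral (T n) {T n<..u} (position x n)) + walk_density T n x * alive_integral (T n) u g (position x n)) \<partial>grid_lebesgue n)"
    by (simp add: distrib_left nn_integral_add nn_integral_cmult[symmetric] ac_simps)
  also have "\<dots> = ?dead + (\<integral>\<^sup>+ x. (G x * transition_integral (T n) u g (position x n)) * (walk_density T n x * phi_integral (T n) {T n<..} (position x n)) \<partial>grid_lebesgue n)"
    using AE_transition_identity[OF T g]
    by (intro arg_cong[where f="\<lambda>c. ?dead + c"] nn_integral_cong_AE, eventually_elim) (simp add: mult.assoc)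
  also have "\<dots> = ?dead + (\<integral>\<^sup>+ \<omega>. G (observation T n \<omega>) * transition_integral (T n) u g (position (observation T n \<omega>) n) * indicator {T n<..} (\<tau> \<omega>) \<partial>M)"
    by (subst nn_integral_observation[OF T(1)]) auto
  also have "\<dots> = (\<integral>\<^sup>+ \<omega>. G (observation T n \<omega>) * g z * indicator {..T n} (\<tau> \<omega>)
      + G (observation T n \<omega>) * transition_integral (T n) u g (position (observation T n \<omega>) n) * indicator {T n<..} (\<tau> \<omega>) \<partial>M)"
    by (rule nn_integral_add[symmetric]) measurable
  also have "\<dots> = (\<integral>\<^sup>+ \<omega>. G (observation T n \<omega>) * transition_integral (T n) u g (\<zeta> (T n) \<omega>) \<partial>M)"
    using AE_absorbed[OF T0] AE_observation[OF T(1)]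
    by (intro nn_integral_cong_AE, eventually_elim) (auto simp: indicator_def transition_integral_absorbed)
  finally show ?thesis .
qed

section \<open>Conditioning on the past\<close>

abbreviation past_space :: "real \<Rightarrow> (real \<Rightarrow> real) measure" where
  "past_space t \<equiv> \<Pi>\<^sub>M s\<in>{0..t}. borel"

definition past :: "real \<Rightarrow> 'a \<Rightarrow> real \<Rightarrow> real" where
  "past t \<omega> = (\<lambda>s\<in>{0..t}. \<zeta> s \<omega>)"

lemma past_measurable [measurable]: "past t \<in> measurable M (past_space t)"
  unfolding past_def by (intro measurable_restrict) auto

text \<open>
  Both sides are finite measures of \<open>B\<close> on the space of paths restricted to \<open>[0, t]\<close>, so it suffices to
  compare them on cylinder sets, where \<open>transition\<close> applies after passing to a grid.  Finiteness is the
  reason for the integrability assumption on \<open>g(\<zeta>\<^sub>u)\<close>.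
\<close>

lemma transition_past:
  assumes t: "0 \<le> t" "t < u" "t = 0 \<longrightarrow> z \<noteq> 0"
    and g [measurable]: "g \<in> borel_measurable borel"
    and fin: "(\<integral>\<^sup>+ \<omega>. g (\<zeta> u \<omega>) \<partial>M) \<noteq> \<infinity>"
    and B: "B \<in> sets (past_space t)"
  shows "(\<integral>\<^sup>+ \<omega>. indicator B (past t \<omega>) * g (\<zeta> u \<omega>) \<partial>M) =
    (\<integral>\<^sup>+ \<omega>. indicator B (past t \<omega>) * transition_integral t u g (\<zeta> t \<omega>) \<partial>M)"
proof -
  note [measurable] = bridge_measurable[OF t(1)] bridge_measurable[of u, OF order.trans[OF t(1) less_imp_le[OF t(2)]]]
  let ?L = "distr (density M (\<lambda>\<omega>. g (\<zeta> u \<omega>))) (past_space t) (past t)"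
  let ?R = "distr (density M (\<lambda>\<omega>. transition_integral t u g (\<zeta> t \<omega>))) (past_space t) (past t)"
  have "?L = ?R"
  proof (rule measure_eqI_PiM_infinite)
    show "finite_measure ?L"
    proof
      have "emeasure ?L (space ?L) = (\<integral>\<^sup>+ \<omega>. indicator (space (past_space t)) (past t \<omega>) * g (\<zeta> u \<omega>) \<partial>M)"
        by (subst emeasure_distr_density) simp_all
      also have "\<dots> \<le> (\<integral>\<^sup>+ \<omega>. g (\<zeta> u \<omega>) \<partial>M)"
        by (intro nn_integral_mono) (simp add: indicator_def)
      finally show "emeasure ?L (space ?L) \<noteq> \<infinity>"
        using fin by (auto simp: top_unique)
    qed
    fix A :: "real \<Rightarrow> real set" and J
    assume J: "finite J" "J \<subseteq> {0..t}" and A: "\<And>i. i \<in> J \<Longrightarrow> A i \<in> sets borel"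
    let ?E = "prod_emb {0..t} (\<lambda>_. borel) J (Pi\<^sub>E J A)"
    have E: "?E \<in> sets (past_space t)"
      using J A by (intro sets_PiM_I) auto
    from grid_ending_at[OF J t(1)] obtain T n where T: "grid T n" "T n = t" "J \<subseteq> T ` {..n}" .
    then have "\<forall>s\<in>J. \<exists>i. i \<le> n \<and> T i = s" by auto
    then obtain idx where idx: "\<And>s. s \<in> J \<Longrightarrow> idx s \<le> n \<and> T (idx s) = s" by metis
    \<comment> \<open>The cylinder event in terms of the grid; index \<open>0\<close> may occur, since \<open>position x 0 = 0\<close>
      matches \<open>\<zeta>\<^sub>0 = 0\<close>.\<close>
    define G :: "(nat \<Rightarrow> real) \<Rightarrow> ennreal" where "G x = (\<Prod>s\<in>J. indicator (A s) (position x (idx s)))" for x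
    have G: "G \<in> borel_measurable (grid_lebesgue n)"
      unfolding G_def
    proof (rule borel_measurable_prod_ennreal)
      fix s assume s: "s \<in> J"
      have [measurable]: "A s \<in> sets borel" "(\<lambda>x. position x (idx s)) \<in> borel_measurable (grid_lebesgue n)"
        using A idx s by (auto intro: measurable_position)
      show "(\<lambda>x. indicator (A s) (position x (idx s)) :: ennreal) \<in> borel_measurable (grid_lebesgue n)"
        by measurable
    qed
    have cyl: "AE \<omega> in M. (indicator ?E (past t \<omega>) :: ennreal) = G (observation T n \<omega>)"
      using AE_observation[OF T(1)]
    proof eventually_elim
      case (elim \<omega>)
      have "past t \<omega> \<in> ?E \<longleftrightarrow> (\<forall>s\<in>J. \<zeta> s \<omega> \<in> A s)"
        using J(2) by (auto simp: prod_emb_def past_def PiE_iff)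
      also have "\<dots> \<longleftrightarrow> (\<forall>s\<in>J. position (observation T n \<omega>) (idx s) \<in> A s)"
        using idx elim by (metis (no_types, lifting))
      finally show ?case
        unfolding G_def prod_indicator_eq[OF J(1)] by (simp add: indicator_def)
    qed
    have "emeasure ?L ?E = (\<integral>\<^sup>+ \<omega>. G (observation T n \<omega>) * g (\<zeta> u \<omega>) \<partial>M)"
      using cyl E by (subst emeasure_distr_density)
        (auto intro!: nn_integral_cong_AE elim!: eventually_mono)
    also have "\<dots> = (\<integral>\<^sup>+ \<omega>. G (observation T n \<omega>) * transition_integral t u g (\<zeta> t \<omega>) \<partial>M)"
      using transition[OF T(1) _ _ g G, of u] t T(2) by simp
    also have "\<dots> = emeasure ?R ?E"
      using cyl E by (subst emeasure_distr_density)
        (auto intro!: nn_integral_cong_AE elim!: eventually_mono)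
    finally show "emeasure ?L ?E = emeasure ?R ?E" .
  qed simp_all
  then have "emeasure ?L B = emeasure ?R B" by simp
  then show ?thesis
    using B by (simp add: emeasure_distr_density)
qed

text \<open>
  The \<open>\<sigma>\<close>-algebra \<open>F\<close> is general so that it can be both the whole past and the present
  \<open>\<sigma>(\<zeta>\<^sub>t)\<close>: the conditional expectations given these two then agree with the same function of
  \<open>\<zeta>\<^sub>t\<close>, which is the Markov property.
\<close>

lemma nn_cond_exp_transition:
  assumes t: "0 \<le> t" "t < u" "t = 0 \<longrightarrow> z \<noteq> 0"
    and g [measurable]: "g \<in> borel_measurable borel"
    and fin: "(\<integral>\<^sup>+ \<omega>. g (\<zeta> u \<omega>) \<partial>M) \<noteq> \<infinity>"
    and F: "space F = space M" "sets F \<subseteq> sets (vimage_algebra (space M) (past t) (past_space t))"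
    and adapted [measurable]: "\<zeta> t \<in> borel_measurable F"
  shows "AE \<omega> in M. transition_integral t u g (\<zeta> t \<omega>) = nn_cond_exp M F (\<lambda>\<omega>. g (\<zeta> u \<omega>)) \<omega>"
proof -
  note [measurable] = bridge_measurable[of u, OF order.trans[OF t(1) less_imp_le[OF t(2)]]]
  have F_eq: "\<exists>B\<in>sets (past_space t). A = past t -` B \<inter> space M" if "A \<in> sets F" for A
    using F(2) that measurable_space[OF past_measurable[of t]]
    by (subst (asm) sets_vimage_algebra2) auto
  have "subalgebra M F"
    unfolding subalgebra_def using F(1) F_eq measurable_sets[OF past_measurable[of t]] by blast
  then interpret finite_measure_subalgebra M F
    by unfold_locales
  show ?thesis
  proof (rule nn_cond_exp_charact)
    fix A assume "A \<in> sets F"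
    from F_eq[OF this] obtain B where B: "B \<in> sets (past_space t)" "A = past t -` B \<inter> space M" by blast
    have ind: "(\<integral>\<^sup>+ \<omega>\<in>A. h \<omega> \<partial>M) = (\<integral>\<^sup>+ \<omega>. indicator B (past t \<omega>) * h \<omega> \<partial>M)" for h
      using B(2) by (intro nn_integral_cong) (auto simp: indicator_def)
    show "(\<integral>\<^sup>+ \<omega>\<in>A. g (\<zeta> u \<omega>) \<partial>M) = (\<integral>\<^sup>+ \<omega>\<in>A. transition_integral t u g (\<zeta> t \<omega>) \<partial>M)"
      unfolding ind by (rule transition_past[OF t g fin B(1)])
  qed measurable
qed

lemma space_natural_filtration: "space (natural_filtration M \<zeta> t) = space M"
  by (simp add: natural_filtration_def space_measure_of_conv)

lemma sets_natural_filtration: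
  "sets (natural_filtration M \<zeta> t) = sigma_sets (space M) {\<zeta> s -` A \<inter> space M | s A. 0 \<le> s \<and> s \<le> t \<and> A \<in> sets borel}"
  unfolding natural_filtration_def by (rule sets_measure_of) auto

lemma natural_filtration_subset_past:
  "sets (natural_filtration M \<zeta> t) \<subseteq> sets (vimage_algebra (space M) (past t) (past_space t))"
proof -
  have "\<zeta> s -` A \<inter> space M \<in> sets (vimage_algebra (space M) (past t) (past_space t))"
    if "0 \<le> s" "s \<le> t" "A \<in> sets borel" for s A
  proof -
    have "(\<lambda>x. x s) \<in> borel_measurable (past_space t)"
      using that by (intro measurable_component_singleton) auto
    from measurable_sets[OF this that(3)]
    have "past t -` ((\<lambda>x. x s) -` A \<inter> space (past_space t)) \<inter> space M
        \<in> sets (vimage_algebra (space M) (past t) (past_space t))"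
      by (rule in_vimage_algebra)
    also have "past t -` ((\<lambda>x. x s) -` A \<inter> space (past_space t)) \<inter> space M = \<zeta> s -` A \<inter> space M"
      using that measurable_space[OF past_measurable[of t]] by (auto simp: past_def)
    finally show ?thesis .
  qed
  then have "{\<zeta> s -` A \<inter> space M | s A. 0 \<le> s \<and> s \<le> t \<and> A \<in> sets borel}
      \<subseteq> sets (vimage_algebra (space M) (past t) (past_space t))"
    by blast
  from sets.sigma_sets_subset[OF this] show ?thesis
    by (simp add: sets_natural_filtration)
qed

lemma vimage_subset_natural_filtration:
  assumes "0 \<le> t"
  shows "sets (vimage_algebra (space M) (\<zeta> t) borel) \<subseteq> sets (natural_filtration M \<zeta> t)"
  unfolding sets_natural_filtration using assms
  by (subst sets_vimage_algebra2) (auto intro!: sigma_sets.Basic)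

lemma adapted_natural_filtration:
  assumes "0 \<le> t" shows "\<zeta> t \<in> borel_measurable (natural_filtration M \<zeta> t)"
proof (rule measurableI)
  fix A :: "real set" assume "A \<in> sets borel"
  then show "\<zeta> t -` A \<inter> space (natural_filtration M \<zeta> t) \<in> sets (natural_filtration M \<zeta> t)"
    unfolding sets_natural_filtration space_natural_filtration using assms
    by (auto intro!: sigma_sets.Basic)
qed simp

lemma natural_filtration_0:
  "natural_filtration M \<zeta> 0 = vimage_algebra (space M) (\<zeta> 0) borel"
proof -
  have "{\<zeta> s -` A \<inter> space M | s A. 0 \<le> s \<and> s \<le> 0 \<and> A \<in> sets borel} = {\<zeta> 0 -` A \<inter> space M | A. A \<in> sets borel}"
    by (auto dest: order.antisym)
  then show ?thesis
    unfolding natural_filtration_def vimage_algebra_def by simp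
qed

theorem markov: "markov_process M (natural_filtration M \<zeta>) \<zeta>"
  unfolding markov_process_def
proof (intro allI impI, elim conjE)
  fix t u and g :: "real \<Rightarrow> real"
  assume t: "0 \<le> t" "t < u" and g [measurable]: "g \<in> borel_measurable borel"
    and int: "integrable M (\<lambda>\<omega>. g (\<zeta> u \<omega>))"
  show "AE \<omega> in M. real_cond_exp M (natural_filtration M \<zeta> t) (\<lambda>\<omega>. g (\<zeta> u \<omega>)) \<omega> =
     real_cond_exp M (vimage_algebra (space M) (\<zeta> t) borel) (\<lambda>\<omega>. g (\<zeta> u \<omega>)) \<omega>"
  proof (cases "t = 0")
    case True
    then show ?thesis by (simp add: natural_filtration_0)
  next
    case False
    have eq: "AE \<omega> in M. nn_cond_exp M (natural_filtration M \<zeta> t) (\<lambda>\<omega>. h (\<zeta> u \<omega>)) \<omega> =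
      nn_cond_exp M (vimage_algebra (space M) (\<zeta> t) borel) (\<lambda>\<omega>. h (\<zeta> u \<omega>)) \<omega>"
      if h: "h \<in> borel_measurable borel" "(\<integral>\<^sup>+ \<omega>. h (\<zeta> u \<omega>) \<partial>M) \<noteq> \<infinity>" for h :: "real \<Rightarrow> ennreal"
    proof -
      have "AE \<omega> in M. transition_integral t u h (\<zeta> t \<omega>) = nn_cond_exp M (natural_filtration M \<zeta> t) (\<lambda>\<omega>. h (\<zeta> u \<omega>)) \<omega>"
        using t False h
        by (intro nn_cond_exp_transition space_natural_filtration natural_filtration_subset_past
            adapted_natural_filtration) auto
      moreover have "AE \<omega> in M. transition_integral t u h (\<zeta> t \<omega>) =
          nn_cond_exp M (vimage_algebra (space M) (\<zeta> t) borel) (\<lambda>\<omega>. h (\<zeta> u \<omega>)) \<omega>"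
        using t False h natural_filtration_subset_past[of t] vimage_subset_natural_filtration[OF t(1)]
        by (intro nn_cond_exp_transition measurable_vimage_algebra1) auto
      ultimately show ?thesis by eventually_elim simp
    qed
    have "AE \<omega> in M. nn_cond_exp M (natural_filtration M \<zeta> t) (\<lambda>\<omega>. ennreal (g (\<zeta> u \<omega>))) \<omega> =
      nn_cond_exp M (vimage_algebra (space M) (\<zeta> t) borel) (\<lambda>\<omega>. ennreal (g (\<zeta> u \<omega>))) \<omega>"
      using eq[of "\<lambda>y. ennreal (g y)"] int by (simp add: real_integrable_def)
    moreover have "AE \<omega> in M. nn_cond_exp M (natural_filtration M \<zeta> t) (\<lambda>\<omega>. ennreal (- g (\<zeta> u \<omega>))) \<omega> =
      nn_cond_exp M (vimage_algebra (space M) (\<zeta> t) borel) (\<lambda>\<omega>. ennreal (- g (\<zeta> u \<omega>))) \<omega>"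
      using eq[of "\<lambda>y. ennreal (- g y)"] int by (simp add: real_integrable_def)
    ultimately show ?thesis
      unfolding real_cond_exp_def by eventually_elim simp
  qed
qed

text \<open>
  The joint law of \<open>\<zeta>\<^sub>t\<close> and \<open>\<zeta>\<^sub>u\<close> is \<open>transition_past\<close> for an event that involves the present
  only.  That the kernel has total mass \<open>1\<close> almost everywhere follows from the same identity with
  \<open>\<zeta>\<^sub>u\<close> unrestricted, by uniqueness of densities.
\<close>

theorem transition_law:
  assumes t: "0 \<le> t" "t < u" "t = 0 \<longrightarrow> z \<noteq> 0"
  shows "cond_distribution M borel (\<zeta> t) borel (\<zeta> u) (bridge_transition \<psi> P z t u)"
proof -
  let ?K = "bridge_transition \<psi> P z t u"
  have u: "0 \<le> u" using t by simp
  note [measurable] = bridge_measurable[OF t(1)] bridge_measurable[OF u]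
  have K: "emeasure (?K x) A = transition_integral t u (indicator A) x" if "A \<in> sets borel" for x A
    using that by (simp add: transition_integral_def bridge_transition_def)
  have law: "emeasure M {\<omega> \<in> space M. \<zeta> t \<omega> \<in> B \<and> \<zeta> u \<omega> \<in> A}
      = (\<integral>\<^sup>+ x\<in>B. emeasure (?K x) A \<partial>distr M borel (\<zeta> t))"
    if A [measurable]: "A \<in> sets borel" and B [measurable]: "B \<in> sets borel" for A B
  proof -
    let ?B = "(\<lambda>x. x t) -` B \<inter> space (past_space t)"
    have "(\<lambda>x. x t) \<in> borel_measurable (past_space t)"
      using t(1) by (intro measurable_component_singleton) auto
    then have B': "?B \<in> sets (past_space t)" using B by (rule measurable_sets)
    have ind: "indicator ?B (past t \<omega>) = (indicator B (\<zeta> t \<omega>) :: ennreal)" if "\<omega> \<in> space M" for \<omega>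
      using that t(1) measurable_space[OF past_measurable[of t]] by (auto simp: indicator_def past_def)
    have "emeasure M {\<omega> \<in> space M. \<zeta> t \<omega> \<in> B \<and> \<zeta> u \<omega> \<in> A}
        = (\<integral>\<^sup>+ \<omega>. indicator {\<omega> \<in> space M. \<zeta> t \<omega> \<in> B \<and> \<zeta> u \<omega> \<in> A} \<omega> \<partial>M)"
      by (rule nn_integral_indicator[symmetric]) measurable
    also have "\<dots> = (\<integral>\<^sup>+ \<omega>. indicator ?B (past t \<omega>) * indicator A (\<zeta> u \<omega>) \<partial>M)"
      by (intro nn_integral_cong) (simp only: ind, auto simp: indicator_def)
    also have "\<dots> = (\<integral>\<^sup>+ \<omega>. indicator ?B (past t \<omega>) * transition_integral t u (indicator A) (\<zeta> t \<omega>) \<partial>M)"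
    proof (rule transition_past[OF t _ _ B'])
      have "(\<integral>\<^sup>+ \<omega>. indicator A (\<zeta> u \<omega>) \<partial>M) \<le> (\<integral>\<^sup>+ \<omega>. 1 \<partial>M)"
        by (intro nn_integral_mono) (simp add: indicator_def)
      then show "(\<integral>\<^sup>+ \<omega>. indicator A (\<zeta> u \<omega>) \<partial>M) \<noteq> \<infinity>"
        by (auto simp: emeasure_space_1 top_unique)
    qed simp
    also have "\<dots> = (\<integral>\<^sup>+ \<omega>. transition_integral t u (indicator A) (\<zeta> t \<omega>) * indicator B (\<zeta> t \<omega>) \<partial>M)"
      by (intro nn_integral_cong) (simp only: ind mult.commute)
    also have "\<dots> = (\<integral>\<^sup>+ x\<in>B. emeasure (?K x) A \<partial>distr M borel (\<zeta> t))"
      by (simp add: K nn_integral_distr)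
    finally show ?thesis .
  qed
  interpret T: prob_space "distr M borel (\<zeta> t)"
    by (rule prob_space_distr) simp
  have "AE x in distr M borel (\<zeta> t). emeasure (?K x) UNIV = 1"
  proof (rule T.density_unique2)
    fix B assume "B \<in> sets (distr M borel (\<zeta> t))"
    then have B [measurable]: "B \<in> sets borel" by simp
    have "(\<integral>\<^sup>+ x\<in>B. emeasure (?K x) UNIV \<partial>distr M borel (\<zeta> t)) = emeasure M {\<omega> \<in> space M. \<zeta> t \<omega> \<in> B \<and> \<zeta> u \<omega> \<in> UNIV}"
      using law[of UNIV B] by simp
    also have "\<dots> = emeasure (distr M borel (\<zeta> t)) B"
      by (simp add: emeasure_distr vimage_def Int_def conj_commute)
    finally show "(\<integral>\<^sup>+ x\<in>B. emeasure (?K x) UNIV \<partial>distr M borel (\<zeta> t)) = (\<integral>\<^sup>+ x\<in>B. 1 \<partial>distr M borel (\<zeta> t))"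
      by simp
  qed (simp_all add: K)
  then have "AE x in distr M borel (\<zeta> t). prob_space (?K x)"
    by eventually_elim (auto intro!: prob_spaceI simp: bridge_transition_def sets_eq_imp_space_eq[OF sets_dirac_plus_lebesgue])
  moreover have "sets (?K x) = sets borel" for x
    by (simp add: bridge_transition_def)
  moreover have "(\<lambda>x. emeasure (?K x) A) \<in> borel_measurable borel" if "A \<in> sets borel" for A
    using that by (simp add: K)
  ultimately show ?thesis
    unfolding cond_distribution_def using law by simp
qed

end

theorem theorem3p9:
  fixes M :: "'a measure"
    and X \<zeta> :: "real \<Rightarrow> 'a \<Rightarrow> real"
    and \<psi> :: "real \<Rightarrow> real"
    and \<tau> :: "'a \<Rightarrow> real"
    and z :: real
  assumes "prob_space M" and "complete_measure M"
    and "levy_process M X" and "symmetric_process M X"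
    and "characteristic_exponent M X \<psi>"
    and "\<And>t. 0 < t \<Longrightarrow> integrable lborel (\<lambda>u. exp (t * \<psi> u))"
    and "\<tau> \<in> borel_measurable M" and "\<And>\<omega>. \<omega> \<in> space M \<Longrightarrow> 0 < \<tau> \<omega>"
    and "z \<in> bridge_endpoints M \<psi> \<tau>"
    and "random_length_bridge M \<psi> \<tau> z \<zeta>"
  shows "markov_process M (natural_filtration M \<zeta>) \<zeta> \<and>
    (\<forall>t u. 0 \<le> t \<and> t < u \<and> \<not> (t = 0 \<and> z = 0) \<longrightarrow>
       cond_distribution M borel (\<zeta> t) borel (\<zeta> u)
         (bridge_transition \<psi> (distr M borel \<tau>) z t u))"
proof -
  from assms(10) obtain Q where
    \<zeta>: "\<And>t. 0 \<le> t \<Longrightarrow> \<zeta> t \<in> borel_measurable M" and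
    Q: "cond_distribution M borel \<tau> skorohod_space (\<lambda>\<omega>. \<lambda>t\<in>{0..}. \<zeta> t \<omega>) Q"
      "AE r in distr M borel \<tau>. levy_bridge \<psi> r z (Q r) (\<lambda>t w. w t)"
    unfolding random_length_bridge_def by blast
  \<comment> \<open>The exponent is measurable because \<open>exp \<circ> \<psi>\<close> is integrable.\<close>
  have "(\<lambda>u. ln (exp (1 * \<psi> u))) \<in> borel_measurable borel"
    using borel_measurable_integrable[OF assms(6)[of 1]] by (intro borel_measurable_ln) simp
  then have \<psi>: "\<psi> \<in> borel_measurable borel" by simp
  interpret prob_space M by fact
  interpret random_bridge M \<psi> \<tau> z \<zeta> Q
    using levy_density_nonneg[OF assms(3,5,6)] assms(7) \<psi> \<zeta> Q by unfold_locales auto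
  show ?thesis
    using markov transition_law by auto
qed

end
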